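(* Let $d\ge2$, $\alpha\in[1,\infty)$ and let $A,B$ be subsets of $\mathbb R^d$. Write $\mathrm{cap}(E,\mathcal{BV}_{\mathcal H_\alpha}(\mathbb R^d))$ for the $\alpha$-HBV capacity of $E$. (i) $\mathrm{cap}(\emptyset,\mathcal{BV}_{\mathcal H_\alpha}(\mathbb R^d))=0$. (ii) If $A\subseteq B$, then $\mathrm{cap}(A,\mathcal{BV}_{\mathcal H_\alpha}(\mathbb R^d))\le\mathrm{cap}(B,\mathcal{BV}_{\mathcal H_\alpha}(\mathbb R^d))$. (iii) $$\mathrm{cap}(A\cup B,\mathcal{BV}_{\mathcal H_\alpha}(\mathbb R^d))+\mathrm{cap}(A\cap B,\mathcal{BV}_{\mathcal H_\alpha}(\mathbb R^d))\le\mathrm{cap}(A,\mathcal{BV}_{\mathcal H_\alpha}(\mathbb R^d))+\mathrm{cap}(B,\mathcal{BV}_{\mathcal H_\alpha}(\mathbb R^d)).$$ (iv) If $A_k$, $k=1,2,\ldots$, are subsets of $\mathbb R^d$, then $$\mathrm{cap}\Big(\bigcup_{k=1}^\infty A_k,\mathcal{BV}_{\mathcal H_\alpha}(\mathbb R^d)\Big)\le\sum_{k=1}^\infty\mathrm{cap}(A_k,\mathcal{BV}_{\mathcal H_\alpha}(\mathbb R^d)).$$ (v) For any sequence $\{A_k\}_{k=1}^\infty$ of subsets of $\mathbb R^d$ with $A_1\subseteq A_2\subseteq A_3\subseteq\cdots$, $$\lim_{k\to\infty}\mathrm{cap}(A_k,\mathcal{BV}_{\mathcal H_\alpha}(\mathbb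 R^d))=\mathrm{cap}\Big(\bigcup_{k=1}^\infty A_k,\mathcal{BV}_{\mathcal H_\alpha}(\mathbb R^d)\Big).$$ (vi) If $A_k$, $k=1,2,\ldots$, are compact sets in $\mathbb R^d$ and $A_1\supseteq A_2\supseteq A_3\supseteq\cdots$, then $$\lim_{k\to\infty}\mathrm{cap}(A_k,\mathcal{BV}_{\mathcal H_\alpha}(\mathbb R^d))=\mathrm{cap}\Big(\bigcap_{k=1}^\infty A_k,\mathcal{BV}_{\mathcal H_\alpha}(\mathbb R^d)\Big).$$
   Context: For $i=1,\dots,d$ put $A^{\pm}_{i,\alpha}=\partial_{x_i}\pm\sqrt{\alpha-1}\,x_i|x|^{(\alpha-2)/2}$ (the second term acting by multiplication). For $\varphi=(\varphi_1,\dots,\varphi_{2d})\in C^1(\mathbb R^d;\mathbb R^{2d})$, $$\mathrm{div}_{\mathcal H_\alpha}\varphi=A^+_{d,\alpha}\varphi_1+\cdots+A^+_{1,\alpha}\varphi_d+A^-_{1,\alpha}\varphi_{d+1}+\cdots+A^-_{d,\alpha}\varphi_{2d}.$$ $\mathcal F(\mathbb R^d)$ is the class of $\varphi\in C^1_c(\mathbb R^d;\mathbb R^{2d})$ with $\sup_x(|\varphi_1(x)|^2+\cdots+|\varphi_{2d}(x)|^2)^{1/2}\le1$. The $\alpha$-Hermite variation of $f\in L^1(\mathbb R^d)$ is $\|\nabla_{\mathcal H_\alpha}f\|(\mathbb R^d)=\sup_{\varphi\in\mathcal F(\mathbb R^d)}\int f\,\mathrm{div}_{\mathcal H_\alpha}\varphi\,dx$;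 $\mathcal{BV}_{\mathcal H_\alpha}(\mathbb R^d)$ is the set of $f\in L^1(\mathbb R^d)$ for which it is finite. For $E\subseteq\mathbb R^d$, $\mathcal A(E,\mathcal{BV}_{\mathcal H_\alpha}(\mathbb R^d))$ is the class of $f\in\mathcal{BV}_{\mathcal H_\alpha}(\mathbb R^d)$ with $0\le f\le1$ and $f=1$ in a neighborhood of $E$ (an open set containing $E$). The $\alpha$-HBV capacity of $E$ is $$\mathrm{cap}(E,\mathcal{BV}_{\mathcal H_\alpha}(\mathbb R^d))=\inf_{f\in\mathcal A(E,\mathcal{BV}_{\mathcal H_\alpha}(\mathbb R^d))}\big\{\|f\|_{L^1}+\|\nabla_{\mathcal H_\alpha}f\|(\mathbb R^d)\big\}$$ (with $\inf\emptyset=\infty$). *)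

theory Defs
  imports "HOL-Analysis.Analysis"
begin

definition partial_deriv :: "'d::finite \<Rightarrow> (real^'d \<Rightarrow> real) \<Rightarrow> real^'d \<Rightarrow> real" where
  "partial_deriv i g x = deriv (\<lambda>t. g (x + t *\<^sub>R axis i 1)) 0"

(* For alpha < 2 the exponent is negative; at x = 0 the product is 0 (because x $ i = 0),
   which is its continuous extension, as alpha > 0. *)
definition hermite_potential :: "real \<Rightarrow> 'd::finite \<Rightarrow> real^'d \<Rightarrow> real" where
  "hermite_potential \<alpha> i x = sqrt (\<alpha> - 1) * (x $ i * norm x powr ((\<alpha> - 2) / 2))"

definition hermite_A_plus :: "real \<Rightarrow> 'd::finite \<Rightarrow> (real^'d \<Rightarrow> real) \<Rightarrow> real^'d \<Rightarrow> real" where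
  "hermite_A_plus \<alpha> i g x = partial_deriv i g x + hermite_potential \<alpha> i x * g x"

definition hermite_A_minus :: "real \<Rightarrow> 'd::finite \<Rightarrow> (real^'d \<Rightarrow> real) \<Rightarrow> real^'d \<Rightarrow> real" where
  "hermite_A_minus \<alpha> i g x = partial_deriv i g x - hermite_potential \<alpha> i x * g x"

(* The 2d components of a field are indexed by 'd + 'd: Inl i is the component acted on by
   A^+_i (number d + 1 - i in the usual numbering), Inr i the one acted on by A^-_i
   (number d + i). *)
definition hermite_div :: "real \<Rightarrow> (real^'d \<Rightarrow> real^('d + 'd)) \<Rightarrow> real^'d::finite \<Rightarrow> real" where
  "hermite_div \<alpha> \<phi> x =
     (\<Sum>i\<in>UNIV. hermite_A_plus \<alpha> i (\<lambda>y. \<phi> y $ Inl i) x) +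
     (\<Sum>i\<in>UNIV. hermite_A_minus \<alpha> i (\<lambda>y. \<phi> y $ Inr i) x)"

definition C1_map :: "('a::real_normed_vector \<Rightarrow> 'b::real_normed_vector) \<Rightarrow> bool" where
  "C1_map \<phi> \<longleftrightarrow>
     (\<exists>\<phi>' :: 'a \<Rightarrow> 'a \<Rightarrow>\<^sub>L 'b.
        (\<forall>x. (\<phi> has_derivative blinfun_apply (\<phi>' x)) (at x)) \<and> continuous_on UNIV \<phi>')"

definition test_fields :: "(real^'d::finite \<Rightarrow> real^('d + 'd)) set" where
  "test_fields =
     {\<phi>. C1_map \<phi> \<and> compact (closure {x. \<phi> x \<noteq> 0}) \<and> (\<forall>x. norm (\<phi> x) \<le> 1)}"

definition hermite_variation :: "real \<Rightarrow> (real^'d::finite \<Rightarrow> real) \<Rightarrow> ereal" where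
  "hermite_variation \<alpha> f =
     (SUP \<phi>\<in>test_fields. ereal (LINT x|lebesgue. f x * hermite_div \<alpha> \<phi> x))"

definition hermite_BV :: "real \<Rightarrow> (real^'d::finite \<Rightarrow> real) set" where
  "hermite_BV \<alpha> = {f. integrable lebesgue f \<and> hermite_variation \<alpha> f < \<infinity>}"

definition cap_admissible :: "real \<Rightarrow> (real^'d::finite) set \<Rightarrow> (real^'d \<Rightarrow> real) set" where
  "cap_admissible \<alpha> E =
     {f \<in> hermite_BV \<alpha>. (\<forall>x. 0 \<le> f x \<and> f x \<le> 1) \<and>
        (\<exists>U. open U \<and> E \<subseteq> U \<and> (\<forall>x\<in>U. f x = 1))}"

definition hbv_cap :: "real \<Rightarrow> (real^'d::finite) set \<Rightarrow> ereal" where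
  "hbv_cap \<alpha> E =
     (INF f\<in>cap_admissible \<alpha> E. ereal (LINT x|lebesgue. \<bar>f x\<bar>) + hermite_variation \<alpha> f)"

end

theory Submission
  imports Defs
begin

text \<open>
  Write \<open>V\<^sub>i(x) = sqrt (\<alpha> - 1) x\<^sub>i |x|^((\<alpha> - 2)/2)\<close> for the potential and \<open>F(f)\<close> for the variation of \<open>f\<close>.
  Everything rests on the submodularity of the variation,
  \<open>F(max f g) + F(min f g) \<le> F(f) + F(g)\<close>, for integrable \<open>f\<close> and \<open>g\<close> with bounded values. For smooth
  functions \<open>F\<close> is the integral of \<open>sqrt (2 |\<nabla>f|\<^sup>2 + 2 |V|\<^sup>2 f\<^sup>2)\<close>; almost everywhere the densities of
  the maximum and the minimum are those of \<open>f\<close> and \<open>g\<close> in some order, whence even equality.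

  For continuously differentiable \<open>f\<close> and \<open>g\<close> the inequality can be read off from the dual definition of \<open>F\<close>
  (\<open>smooth_submodular_duality\<close>): two test fields \<open>\<phi>\<close> and \<open>\<psi>\<close> for the maximum and the minimum are
  recombined into two test fields for \<open>f\<close> and \<open>g\<close>, which exchange roles across \<open>{f = g}\<close>.
  The general case follows by approximation (\<open>hermite_variation_C1_approx\<close>): every bounded integrable
  \<open>f\<close> is the \<open>L\<^sup>1\<close>-limit of continuously differentiable \<open>f\<^sub>n\<close> with \<open>limsup F(f\<^sub>n) \<le> F(f)\<close>. Multiplying by
  a slowly varying cut-off function costs little variation, and for functions with bounded support
  \<open>F\<close> is nearly invariant under small translations because \<open>V\<close> is uniformly continuous on bounded
  sets. As \<open>F\<close> is a supremum of linear functionals, it is then at most slightly larger on a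
  mollification, which is an average of translates. The maximum and the minimum are stable in \<open>L\<^sup>1\<close>,
  and each test field gives an \<open>L\<^sup>1\<close>-continuous functional, so the inequality passes to the limit.

  The capacity inherits submodularity, which is (iii). For (v), near-minimisers \<open>f\<^sub>k\<close> for \<open>A\<^sub>k\<close> are replaced
  by the running maxima \<open>g\<^sub>k = max f\<^sub>1 ... f\<^sub>k\<close>. The minimum of \<open>g\<^sub>k\<close> and \<open>f\<^sub>k\<^sub>+\<^sub>1\<close> is admissible for \<open>A\<^sub>k\<close>, so
  by submodularity the \<open>g\<^sub>k\<close> remain near-minimisers, and their increasing limit is admissible for the
  union (\<open>hbv_cap_increasing_union_le\<close>). Part (iv) follows from (iii) and (v) applied to the partial unions.
  For (vi), a neighbourhood of the intersection of a decreasing sequence of compact sets contains one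
  of them, so every competitor for the intersection is one for that set.
\<close>

section \<open>Calculus of continuously differentiable maps\<close>

lemma C1_mapI:
  fixes f :: "'a::euclidean_space \<Rightarrow> 'b::real_normed_vector"
  assumes "\<And>x. (f has_derivative f' x) (at x)"
    and "\<And>v. continuous_on UNIV (\<lambda>x. f' x v)"
  shows "C1_map f"
proof -
  have bl: "bounded_linear (f' x)" for x
    using assms(1) by (rule has_derivative_bounded_linear)
  then have eq: "blinfun_apply (Blinfun (f' x)) = f' x" for x
    by (rule bounded_linear_Blinfun_apply)
  have "continuous_on UNIV (\<lambda>x. Blinfun (f' x))"
    by (rule continuous_on_blinfun_componentwise) (simp add: eq assms(2))
  then show ?thesis
    unfolding C1_map_def using eq assms(1) by (intro exI[of _ "\<lambda>x. Blinfun (f' x)"]) simp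
qed

lemma C1_mapE:
  assumes "C1_map f"
  obtains f' where "\<And>x. (f has_derivative f' x) (at x)" "\<And>v. continuous_on UNIV (\<lambda>x. f' x v)"
proof -
  obtain F where F: "\<And>x. (f has_derivative blinfun_apply (F x)) (at x)" "continuous_on UNIV F"
    using assms unfolding C1_map_def by blast
  show thesis
    by (rule that[of "\<lambda>x. blinfun_apply (F x)"]) (auto intro!: F continuous_intros)
qed

lemma C1_map_continuous_on: "C1_map f \<Longrightarrow> continuous_on S f"
  by (meson C1_map_def continuous_at_imp_continuous_on has_derivative_continuous)

lemma C1_map_const: "C1_map (\<lambda>x::'a::euclidean_space. c)"
  by (rule C1_mapI[where f' = "\<lambda>x v. 0"]) auto

lemma C1_map_add:
  fixes f g :: "'a::euclidean_space \<Rightarrow> 'b::real_normed_vector"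
  assumes "C1_map f" "C1_map g" shows "C1_map (\<lambda>x. f x + g x)"
proof -
  obtain f' where f: "\<And>x. (f has_derivative f' x) (at x)" "\<And>v. continuous_on UNIV (\<lambda>x. f' x v)"
    using assms(1) by (rule C1_mapE) blast
  obtain g' where g: "\<And>x. (g has_derivative g' x) (at x)" "\<And>v. continuous_on UNIV (\<lambda>x. g' x v)"
    using assms(2) by (rule C1_mapE) blast
  show ?thesis
    by (rule C1_mapI[where f' = "\<lambda>x v. f' x v + g' x v"])
       (auto intro!: derivative_intros continuous_intros f g)
qed

lemma C1_map_scaleR:
  fixes f :: "'a::euclidean_space \<Rightarrow> real" and g :: "'a \<Rightarrow> 'b::real_normed_vector"
  assumes "C1_map f" "C1_map g" shows "C1_map (\<lambda>x. f x *\<^sub>R g x)"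
proof -
  obtain f' where f: "\<And>x. (f has_derivative f' x) (at x)" "\<And>v. continuous_on UNIV (\<lambda>x. f' x v)"
    using assms(1) by (rule C1_mapE) blast
  obtain g' where g: "\<And>x. (g has_derivative g' x) (at x)" "\<And>v. continuous_on UNIV (\<lambda>x. g' x v)"
    using assms(2) by (rule C1_mapE) blast
  show ?thesis
    by (rule C1_mapI[where f' = "\<lambda>x v. f x *\<^sub>R g' x v + f' x v *\<^sub>R g x"])
       (auto intro!: has_derivative_scaleR continuous_intros f g C1_map_continuous_on[OF assms(1)]
          C1_map_continuous_on[OF assms(2)])
qed

lemma C1_map_mult:
  fixes f g :: "'a::euclidean_space \<Rightarrow> real"
  assumes "C1_map f" "C1_map g" shows "C1_map (\<lambda>x. f x * g x)"
  using C1_map_scaleR[OF assms] by simp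

lemma C1_map_diff:
  fixes f g :: "'a::euclidean_space \<Rightarrow> 'b::real_normed_vector"
  assumes "C1_map f" "C1_map g" shows "C1_map (\<lambda>x. f x - g x)"
  using C1_map_add[OF assms(1) C1_map_scaleR[OF C1_map_const[of "-1"] assms(2)]] by simp

lemma C1_map_nth:
  fixes f :: "'a::euclidean_space \<Rightarrow> real^'n::finite"
  assumes "C1_map f" shows "C1_map (\<lambda>x. f x $ j)"
proof -
  obtain f' where f: "\<And>x. (f has_derivative f' x) (at x)" "\<And>v. continuous_on UNIV (\<lambda>x. f' x v)"
    using assms(1) by (rule C1_mapE) blast
  show ?thesis
    by (rule C1_mapI[where f' = "\<lambda>x v. f' x v $ j"])
       (auto intro!: bounded_linear.has_derivative[OF bounded_linear_vec_nth] continuous_intros f)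
qed

lemma C1_map_compose_real:
  fixes f :: "'a::euclidean_space \<Rightarrow> real"
  assumes "C1_map f" "\<And>t. (H has_real_derivative H' t) (at t)" "continuous_on UNIV H'"
  shows "C1_map (\<lambda>x. H (f x))"
proof -
  obtain f' where f: "\<And>x. (f has_derivative f' x) (at x)" "\<And>v. continuous_on UNIV (\<lambda>x. f' x v)"
    using assms(1) by (rule C1_mapE) blast
  have *: "((\<lambda>x. H (f x)) has_derivative (\<lambda>v. H' (f x) * f' x v)) (at x)" for x
    using has_derivative_compose[OF f(1) assms(2)[unfolded has_field_derivative_def]] by simp
  have "continuous_on UNIV (\<lambda>x. H' (f x))"
    using continuous_on_compose2[OF assms(3) C1_map_continuous_on[OF assms(1)]] by auto
  then show ?thesis
    by (intro C1_mapI[OF *]) (auto intro!: continuous_intros f)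
qed

lemma C1_map_affine:
  fixes f :: "'a::euclidean_space \<Rightarrow> 'b::real_normed_vector"
  assumes "C1_map f" shows "C1_map (\<lambda>x. f (c *\<^sub>R x + y))"
proof -
  obtain f' where f: "\<And>x. (f has_derivative f' x) (at x)" "\<And>v. continuous_on UNIV (\<lambda>x. f' x v)"
    using assms(1) by (rule C1_mapE) blast
  have *: "((\<lambda>x. f (c *\<^sub>R x + y)) has_derivative (\<lambda>v. f' (c *\<^sub>R x + y) (c *\<^sub>R v))) (at x)" for x
    by (rule has_derivative_compose[OF _ f(1)]) (auto intro!: derivative_eq_intros)
  show ?thesis
    by (rule C1_mapI[OF *]) (rule continuous_on_compose2[OF f(2)], auto intro!: continuous_intros)
qed

text \<open>The directional derivative along a coordinate axis is the Frechet derivative applied to that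
  axis; the calculus rules for partial derivatives below are read off from this.\<close>

lemma partial_deriv_eq:
  assumes "(f has_derivative f') (at x)"
  shows "partial_deriv i f x = f' (axis i 1)"
proof -
  have "((\<lambda>t. x + t *\<^sub>R axis i 1) has_derivative (\<lambda>t. t *\<^sub>R axis i 1)) (at 0)"
    by (auto intro!: derivative_eq_intros)
  from has_derivative_compose[OF this, of f f'] assms
  have "((\<lambda>t. f (x + t *\<^sub>R axis i 1)) has_derivative (\<lambda>t. f' (t *\<^sub>R axis i 1))) (at 0)"
    by simp
  moreover have "f' (t *\<^sub>R axis i 1) = f' (axis i 1) * t" for t
    using linear_cmul[OF has_derivative_linear[OF assms]] by simp
  ultimately show ?thesis
    unfolding partial_deriv_def
    by (intro DERIV_imp_deriv) (simp add: has_field_derivative_def)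
qed

lemma continuous_on_partial_deriv: "C1_map f \<Longrightarrow> continuous_on S (partial_deriv i f)"
proof -
  assume "C1_map f"
  then obtain f' where f: "\<And>x. (f has_derivative f' x) (at x)" "\<And>v. continuous_on UNIV (\<lambda>x. f' x v)"
    by (rule C1_mapE) blast
  have "partial_deriv i f = (\<lambda>x. f' x (axis i 1))"
    using partial_deriv_eq[OF f(1)] by auto
  then show ?thesis using f(2) continuous_on_subset by (metis subset_UNIV)
qed

lemma partial_deriv_mult:
  assumes "C1_map f" "C1_map g"
  shows "partial_deriv i (\<lambda>x. f x * g x) x = f x * partial_deriv i g x + partial_deriv i f x * g x"
proof -
  obtain f' where f: "\<And>x. (f has_derivative f' x) (at x)" using assms(1) by (rule C1_mapE) blast
  obtain g' where g: "\<And>x. (g has_derivative g' x) (at x)" using assms(2) by (rule C1_mapE) blast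
  show ?thesis
    by (simp add: partial_deriv_eq[OF has_derivative_mult[OF f g]] partial_deriv_eq[OF f] partial_deriv_eq[OF g])
qed

lemma partial_deriv_add:
  assumes "C1_map f" "C1_map g"
  shows "partial_deriv i (\<lambda>x. f x + g x) x = partial_deriv i f x + partial_deriv i g x"
proof -
  obtain f' where f: "\<And>x. (f has_derivative f' x) (at x)" using assms(1) by (rule C1_mapE) blast
  obtain g' where g: "\<And>x. (g has_derivative g' x) (at x)" using assms(2) by (rule C1_mapE) blast
  show ?thesis
    by (simp add: partial_deriv_eq[OF has_derivative_add[OF f g]] partial_deriv_eq[OF f] partial_deriv_eq[OF g])
qed

lemma partial_deriv_compose_real:
  assumes "C1_map f" "(H has_real_derivative h) (at (f x))"
  shows "partial_deriv i (\<lambda>x. H (f x)) x = h * partial_deriv i f x"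
proof -
  obtain f' where f: "\<And>x. (f has_derivative f' x) (at x)" using assms(1) by (rule C1_mapE) blast
  show ?thesis
    using partial_deriv_eq[OF has_derivative_compose[OF f assms(2)[unfolded has_field_derivative_def]]]
    by (simp add: partial_deriv_eq[OF f])
qed

lemma partial_deriv_const: "partial_deriv i (\<lambda>x. c) x = 0"
  by (simp add: partial_deriv_def)

lemma partial_deriv_eq_0:
  assumes "closed K" "x \<notin> K" "\<And>x. x \<notin> K \<Longrightarrow> f x = 0"
  shows "partial_deriv i f x = 0"
proof -
  have "((\<lambda>_. 0) has_derivative (\<lambda>_. 0)) (at x)" by simp
  then have "(f has_derivative (\<lambda>_. 0)) (at x)"
    by (rule has_derivative_transform_within_open[of _ _ _ UNIV "- K"]) (use assms in auto)
  then show ?thesis by (simp add: partial_deriv_eq)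
qed

lemma partial_deriv_shift: "partial_deriv i (\<lambda>x. f (x + y)) x = partial_deriv i f (x + y)"
  by (simp add: partial_deriv_def algebra_simps)

lemma integrable_continuous_compact_support:
  fixes f :: "'a::euclidean_space \<Rightarrow> real"
  assumes "continuous_on UNIV f" "compact K" "\<And>x. x \<notin> K \<Longrightarrow> f x = 0"
  shows "integrable lborel f"
proof -
  have "integrable lborel (\<lambda>x. indicator K x *\<^sub>R f x)"
    using assms by (intro borel_integrable_compact) (auto intro: continuous_on_subset)
  moreover have "(\<lambda>x. indicator K x *\<^sub>R f x) = f"
    using assms(3) by (fastforce simp: indicator_def)
  ultimately show ?thesis by simp
qed

lemma bounded_continuous_compact_support:
  fixes f :: "'a::metric_space \<Rightarrow> real"
  assumes "continuous_on UNIV f" "compact K" "\<And>x. x \<notin> K \<Longrightarrow> f x = 0"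
  obtains M where "M > 0" "\<And>x. \<bar>f x\<bar> \<le> M"
proof -
  have "bounded (f ` K)"
    using assms by (intro compact_imp_bounded compact_continuous_image) (auto intro: continuous_on_subset)
  then obtain M where M: "M > 0" "\<And>x. x \<in> K \<Longrightarrow> \<bar>f x\<bar> \<le> M"
    by (auto simp: bounded_pos)
  show thesis
    by (rule that[of M]) (use M assms(3) in \<open>force+\<close>)
qed

lemma uniformly_continuous_compact_support:
  fixes f :: "'a::euclidean_space \<Rightarrow> 'b::real_normed_vector"
  assumes cont: "continuous_on UNIV f" and "compact K" and zero: "\<And>x. x \<notin> K \<Longrightarrow> f x = 0"
    and "e > 0"
  obtains d where "d > 0" "\<And>x y. norm (x - y) \<le> d \<Longrightarrow> norm (f x - f y) < e"
proof -
  obtain R where R: "\<And>x. x \<in> K \<Longrightarrow> norm x \<le> R"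
    using compact_imp_bounded[OF assms(2)] by (auto simp: bounded_iff)
  have "uniformly_continuous_on (cball 0 (R + 1)) f"
    using cont by (intro compact_uniformly_continuous) (auto intro: continuous_on_subset)
  then obtain d where d: "d > 0" and
    "\<And>x y. x \<in> cball 0 (R + 1) \<Longrightarrow> y \<in> cball 0 (R + 1) \<Longrightarrow> dist y x < d \<Longrightarrow> dist (f y) (f x) < e"
    using \<open>e > 0\<close> unfolding uniformly_continuous_on_def by meson
  note close = this(2)
  show thesis
  proof (rule that[of "min (d / 2) 1"])
    show "min (d / 2) 1 > 0" using d by simp
    fix x y :: 'a assume xy: "norm (x - y) \<le> min (d / 2) 1"
    show "norm (f x - f y) < e"
    proof (cases "x \<in> K \<or> y \<in> K")
      case True
      moreover have "norm x \<le> norm y + 1" "norm y \<le> norm x + 1"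
        using xy norm_triangle_ineq2[of x y] norm_triangle_ineq2[of y x] by (auto simp: norm_minus_commute)
      ultimately have "norm x \<le> R + 1" "norm y \<le> R + 1" using R by force+
      then show ?thesis
        using close[of y x] xy d by (auto simp: dist_norm)
    qed (use zero \<open>e > 0\<close> in auto)
  qed
qed

lemma lborel_integral_shift:
  fixes f :: "'a::euclidean_space \<Rightarrow> real"
  assumes [measurable]: "f \<in> borel_measurable borel"
  shows "(LINT x|lborel. f (x + y)) = (LINT x|lborel. f x)"
proof -
  have "(LINT x|lborel. f x) = (LINT x|distr lborel borel ((+) y). f x)"
    by (simp add: lborel_distr_plus)
  also have "\<dots> = (LINT x|lborel. f (x + y))"
    by (subst integral_distr) (auto simp: add.commute)
  finally show ?thesis by simp
qed

text \<open>Differentiation under the integral sign is justified by the uniform continuity of the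
  derivative of \<open>k\<close>, which bounds the remainder of the linear approximation uniformly in the base
  point; this uniform bound is then integrated against \<open>|u|\<close>.\<close>

lemma correlation_C1:
  fixes k :: "'a::euclidean_space \<Rightarrow> real"
  assumes u: "integrable lborel u"
    and k: "\<And>x. (k has_derivative k' x) (at x)" "\<And>v. continuous_on UNIV (\<lambda>x. k' x v)"
    and K: "compact K" "\<And>x. x \<notin> K \<Longrightarrow> k x = 0"
  shows "((\<lambda>x. LINT z|lborel. u z * k (z - x)) has_derivative
           (\<lambda>v. - (LINT z|lborel. u z * k' (z - x) v))) (at x)"
    and "C1_map (\<lambda>x. LINT z|lborel. u z * k (z - x))"
proof -
  have bl: "bounded_linear (k' x)" for x
    using k(1) by (rule has_derivative_bounded_linear)
  have k'0: "k' x v = 0" if "x \<notin> K" for x v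
  proof -
    have "((\<lambda>_. 0) has_derivative (\<lambda>_. 0)) (at x)" by simp
    then have "(k has_derivative (\<lambda>_. 0)) (at x)"
      by (rule has_derivative_transform_within_open[of _ _ _ UNIV "- K"])
         (use K that in \<open>auto intro: compact_imp_closed\<close>)
    then have "k' x = (\<lambda>_. 0)" using k(1) has_derivative_unique by blast
    then show ?thesis by simp
  qed
  define B where "B x = Blinfun (k' x)" for x
  have B: "blinfun_apply (B x) = k' x" for x
    unfolding B_def using bl by (rule bounded_linear_Blinfun_apply)
  have Bcont: "continuous_on UNIV B"
    by (rule continuous_on_blinfun_componentwise) (simp add: B k(2))
  have B0: "B x = 0" if "x \<notin> K" for x
    by (rule blinfun_eqI) (simp add: B k'0 that)
  have kcont: "continuous_on UNIV k"
    by (meson continuous_at_imp_continuous_on has_derivative_continuous k(1))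
  \<comment> \<open>every integrand below is \<open>u\<close> times a bounded Borel function\<close>
  have int: "integrable lborel (\<lambda>z. u z * w (z - x))"
    if w: "continuous_on UNIV w" and w0: "\<And>x. x \<notin> K \<Longrightarrow> w x = 0" for w :: "'a \<Rightarrow> real" and x
  proof -
    obtain M where M: "\<And>x. \<bar>w x\<bar> \<le> M"
      using bounded_continuous_compact_support[OF w K(1) w0] by metis
    have [measurable]: "w \<in> borel_measurable borel" using w by (rule borel_measurable_continuous_onI)
    have [measurable]: "u \<in> borel_measurable lborel" using u by simp
    show ?thesis
    proof (rule Bochner_Integration.integrable_bound)
      show "integrable lborel (\<lambda>z. M * u z)" using u by simp
      show "AE z in lborel. norm (u z * w (z - x)) \<le> norm (M * u z)"
        using M by (auto simp: abs_mult mult.commute[of M] intro!: mult_left_mono order_trans[OF M])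
    qed measurable
  qed
  note intk = int[OF kcont K(2)] and intk' = int[OF k(2) k'0]
  define U where "U = (LINT z|lborel. \<bar>u z\<bar>)"
  have U0: "U \<ge> 0" by (simp add: U_def)
  have lin: "linear (\<lambda>v. - (LINT z|lborel. u z * k' (z - x) v))" for x
    using intk' linear_add[OF bounded_linear.linear[OF bl]] linear_cmul[OF bounded_linear.linear[OF bl]]
    by (intro linearI) (auto simp: distrib_left mult.left_commute)
  have der: "((\<lambda>x. LINT z|lborel. u z * k (z - x)) has_derivative
           (\<lambda>v. - (LINT z|lborel. u z * k' (z - x) v))) (at x)" for x
    unfolding has_derivative_at_alt
  proof (intro conjI allI impI)
    show "bounded_linear (\<lambda>v. - (LINT z|lborel. u z * k' (z - x) v))"
      using lin by (rule linear_conv_bounded_linear[THEN iffD1])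
    fix e :: real assume "e > 0"
    then have "e / (U + 1) > 0" using U0 by simp
    from uniformly_continuous_compact_support[OF Bcont K(1) B0 this]
    obtain d where d: "d > 0" "\<And>x y. norm (x - y) \<le> d \<Longrightarrow> norm (B x - B y) < e / (U + 1)"
      by metis
    have "norm ((LINT z|lborel. u z * k (z - y)) - (LINT z|lborel. u z * k (z - x)) -
             - (LINT z|lborel. u z * k' (z - x) (y - x))) \<le> e * norm (y - x)"
      if "norm (y - x) < d" for y
    proof -
      have point: "\<bar>k (z - y) - k (z - x) + k' (z - x) (y - x)\<bar> \<le> norm (y - x) * (e / (U + 1))" for z
      proof -
        have "norm (k (z - y) - k (z - x) - k' (z - x) ((z - y) - (z - x)))
            \<le> norm ((z - y) - (z - x)) * (e / (U + 1))"
        proof (rule differentiable_bound_linearization[where S = "cball (z - x) d"])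
          show "z - x + t *\<^sub>R (z - y - (z - x)) \<in> cball (z - x) d" if "t \<in> {0..1}" for t
          proof -
            have "dist (z - x) (z - x + t *\<^sub>R (x - y)) = t * norm (y - x)"
              using that by (simp add: dist_norm norm_minus_commute)
            also have "\<dots> \<le> norm (y - x)" using that by (simp add: mult_left_le_one_le)
            finally show ?thesis using \<open>norm (y - x) < d\<close> by simp
          qed
          show "(k has_derivative k' w) (at w within cball (z - x) d)" for w
            using k(1) has_derivative_at_withinI by blast
          show "onorm (k' w - k' (z - x)) \<le> e / (U + 1)" if "w \<in> cball (z - x) d" for w
          proof -
            have "onorm (k' w - k' (z - x)) = norm (B w - B (z - x))"
              by (simp add: norm_blinfun.rep_eq minus_blinfun.rep_eq B fun_diff_def)
            also have "\<dots> < e / (U + 1)"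
              using d(2)[of w "z - x"] that by (simp add: dist_norm norm_minus_commute)
            finally show ?thesis by simp
          qed
          show "z - x \<in> cball (z - x) d" using d by simp
        qed
        moreover have "k' (z - x) ((z - y) - (z - x)) = - k' (z - x) (y - x)"
          using linear_neg[OF bounded_linear.linear[OF bl], of "z - x" "y - x"]
          by (simp add: minus_diff_eq)
        ultimately show ?thesis by (simp add: norm_minus_commute algebra_simps)
      qed
      have "(LINT z|lborel. u z * k (z - y)) - (LINT z|lborel. u z * k (z - x)) -
             - (LINT z|lborel. u z * k' (z - x) (y - x))
          = (LINT z|lborel. u z * (k (z - y) - k (z - x) + k' (z - x) (y - x)))"
        using intk intk' by (simp add: algebra_simps)
      also have "norm \<dots> \<le> (LINT z|lborel. \<bar>u z\<bar> * (norm (y - x) * (e / (U + 1))))"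
      proof (rule Bochner_Integration.integral_norm_bound_integral)
        show "integrable lborel (\<lambda>z. u z * (k (z - y) - k (z - x) + k' (z - x) (y - x)))"
          using intk[of y] intk[of x] intk'[of x "y - x"] by (simp add: algebra_simps)
        show "integrable lborel (\<lambda>z. \<bar>u z\<bar> * (norm (y - x) * (e / (U + 1))))"
          using u by simp
        show "norm (u z * (k (z - y) - k (z - x) + k' (z - x) (y - x)))
            \<le> \<bar>u z\<bar> * (norm (y - x) * (e / (U + 1)))" for z
          using mult_left_mono[OF point[of z], of "\<bar>u z\<bar>"] by (simp add: abs_mult)
      qed
      also have "\<dots> = (U / (U + 1)) * (e * norm (y - x))"
        by (simp add: U_def)
      also have "\<dots> \<le> 1 * (e * norm (y - x))"
        using U0 \<open>e > 0\<close> by (intro mult_right_mono) auto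
      finally show ?thesis by simp
    qed
    then show "\<exists>d>0. \<forall>y. norm (y - x) < d \<longrightarrow>
        norm ((LINT z|lborel. u z * k (z - y)) - (LINT z|lborel. u z * k (z - x)) -
             - (LINT z|lborel. u z * k' (z - x) (y - x))) \<le> e * norm (y - x)"
      using d(1) by blast
  qed
  show "((\<lambda>x. LINT z|lborel. u z * k (z - x)) has_derivative
           (\<lambda>v. - (LINT z|lborel. u z * k' (z - x) v))) (at x)"
    by (rule der)
  show "C1_map (\<lambda>x. LINT z|lborel. u z * k (z - x))"
  proof (rule C1_mapI[OF der])
    fix v
    have "continuous_on UNIV (\<lambda>x. LINT z|lborel. u z * k' (z - x) v)"
      unfolding continuous_on_iff
    proof (intro ballI allI impI)
      fix x and e :: real assume "e > 0"
      then have "e / (U + 1) > 0" using U0 by simp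
      from uniformly_continuous_compact_support[OF k(2) K(1) k'0 this]
      obtain d where d: "d > 0" "\<And>x y. norm (x - y) \<le> d \<Longrightarrow> norm (k' x v - k' y v) < e / (U + 1)"
        by metis
      have "dist (LINT z|lborel. u z * k' (z - y) v) (LINT z|lborel. u z * k' (z - x) v) < e"
        if "dist y x < d" for y
      proof -
        have "dist (LINT z|lborel. u z * k' (z - y) v) (LINT z|lborel. u z * k' (z - x) v)
            = norm (LINT z|lborel. u z * (k' (z - y) v - k' (z - x) v))"
          using intk' by (simp add: dist_norm right_diff_distrib)
        also have "\<dots> \<le> (LINT z|lborel. \<bar>u z\<bar> * (e / (U + 1)))"
        proof (rule Bochner_Integration.integral_norm_bound_integral)
          show "integrable lborel (\<lambda>z. u z * (k' (z - y) v - k' (z - x) v))"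
            using intk'[of y v] intk'[of x v] by (simp add: right_diff_distrib)
          show "integrable lborel (\<lambda>z. \<bar>u z\<bar> * (e / (U + 1)))" using u by simp
          show "norm (u z * (k' (z - y) v - k' (z - x) v)) \<le> \<bar>u z\<bar> * (e / (U + 1))" for z
            using d(2)[of "z - y" "z - x"] that
            mult_left_mono[of "\<bar>k' (z - y) v - k' (z - x) v\<bar>" "e / (U + 1)" "\<bar>u z\<bar>"]
            by (simp add: abs_mult dist_norm norm_minus_commute)
        qed
        also have "\<dots> = (U / (U + 1)) * e" by (simp add: U_def)
        also have "\<dots> < 1 * e"
          using U0 \<open>e > 0\<close> by (intro mult_strict_right_mono) auto
        finally show ?thesis by simp
      qed
      then show "\<exists>d>0. \<forall>y\<in>UNIV. dist y x < d \<longrightarrow>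
          dist (LINT z|lborel. u z * k' (z - y) v) (LINT z|lborel. u z * k' (z - x) v) < e"
        using d(1) by blast
    qed
    then show "continuous_on UNIV (\<lambda>x. - (LINT z|lborel. u z * k' (z - x) v))"
      by (intro continuous_intros)
  qed
qed

text \<open>Correlating \<open>k\<close> with the indicator function of a large ball gives, near the origin, the
  constant \<open>\<integral>k\<close>; its derivative there is \<open>-\<integral>\<partial>\<^sub>ik\<close>.\<close>

lemma integral_partial_deriv_eq_0:
  fixes k :: "real^'d::finite \<Rightarrow> real"
  assumes "C1_map k" "compact K" "\<And>x. x \<notin> K \<Longrightarrow> k x = 0"
  shows "(LINT x|lborel. partial_deriv i k x) = 0"
proof -
  obtain k' where k: "\<And>x. (k has_derivative k' x) (at x)" "\<And>v. continuous_on UNIV (\<lambda>x. k' x v)"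
    using assms(1) by (rule C1_mapE) blast
  obtain R where R: "\<And>x. x \<in> K \<Longrightarrow> norm x \<le> R"
    using compact_imp_bounded[OF assms(2)] by (auto simp: bounded_iff)
  define u :: "real^'d \<Rightarrow> real" where "u = indicator (cball 0 (R + 1))"
  have u: "integrable lborel u"
    unfolding u_def by (intro integrable_real_indicator emeasure_bounded_finite) auto
  have "(LINT z|lborel. u z * k (z - x)) = (LINT z|lborel. k z)" if "x \<in> ball 0 1" for x
  proof -
    have eq: "u z * k (z - x) = k (z - x)" for z
    proof (cases "z - x \<in> K")
      case True
      then have "norm z \<le> R + 1" using R[of "z - x"] that norm_triangle_ineq[of "z - x" x] by auto
      then show ?thesis by (simp add: u_def)
    qed (use assms(3) in auto)
    then show ?thesis
      unfolding eq using lborel_integral_shift[of k "- x"] borel_measurable_continuous_onI[OF C1_map_continuous_on[OF assms(1)]]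
      by simp
  qed
  note near_0 = this
  have "((\<lambda>x. LINT z|lborel. k z) has_derivative (\<lambda>v. 0)) (at (0 :: real^'d))" by simp
  then have "((\<lambda>x. LINT z|lborel. u z * k (z - x)) has_derivative (\<lambda>v. 0)) (at 0)"
    by (rule has_derivative_transform_within_open[of _ _ _ UNIV "ball 0 1"]) (simp_all add: near_0)
  from has_derivative_unique[OF this correlation_C1(1)[OF u k assms(2,3)]]
  have "(LINT z|lborel. u z * k' z (axis i 1)) = 0"
    by (metis (no_types, lifting) add.inverse_inverse add.inverse_neutral diff_zero Bochner_Integration.integral_cong)
  moreover have "u z * k' z (axis i 1) = partial_deriv i k z" for z
    using partial_deriv_eq[OF k(1), of i z]
      partial_deriv_eq_0[OF compact_imp_closed[OF assms(2)], of z k i] assms(3) R[of z]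
    by (cases "z \<in> K") (auto simp: u_def)
  ultimately show ?thesis by simp
qed

section \<open>The Hermite divergence and the variation\<close>

text \<open>For \<open>\<alpha> < 2\<close> the power of the norm is singular at the origin, but the factor \<open>x\<^sub>i\<close> compensates:
  \<open>|V\<^sub>i(x)| \<le> c |x| powr (\<alpha> / 2)\<close>. Continuity there is what gives uniform continuity on bounded sets,
  on which the approximation argument depends.\<close>

lemma isCont_hermite_potential: "isCont (hermite_potential \<alpha> i) (x :: real^'d::finite)"
  if "\<alpha> > 0"
proof (cases "x = 0")
  case False
  then show ?thesis
    unfolding hermite_potential_def by (intro continuous_intros) auto
next
  case True
  define b where "b = \<alpha> / 2"
  have "b > 0" using that by (simp add: b_def)
  have bound: "norm (hermite_potential \<alpha> i y) \<le> \<bar>sqrt (\<alpha> - 1)\<bar> * norm y powr b" for y :: "real^'d"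
  proof (cases "y = 0")
    case False
    have "norm (hermite_potential \<alpha> i y) = \<bar>sqrt (\<alpha> - 1)\<bar> * (\<bar>y $ i\<bar> * norm y powr ((\<alpha> - 2) / 2))"
      by (simp add: hermite_potential_def abs_mult)
    also have "\<dots> \<le> \<bar>sqrt (\<alpha> - 1)\<bar> * (norm y * norm y powr ((\<alpha> - 2) / 2))"
      by (intro mult_left_mono mult_right_mono component_le_norm_cart) auto
    also have "norm y * norm y powr ((\<alpha> - 2) / 2) = norm y powr (1 + (\<alpha> - 2) / 2)"
      using False by (subst powr_add) simp
    also have "1 + (\<alpha> - 2) / 2 = b" by (simp add: b_def field_simps)
    finally show ?thesis .
  qed (simp add: hermite_potential_def)
  have "((\<lambda>y. norm y powr b) \<longlongrightarrow> 0) (at (0 :: real^'d))"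
    using \<open>b > 0\<close> by (intro tendsto_zero_powrI[where b = b] tendsto_norm_zero tendsto_ident_at) auto
  then have "((\<lambda>y. \<bar>sqrt (\<alpha> - 1)\<bar> * norm y powr b) \<longlongrightarrow> 0) (at (0 :: real^'d))"
    by (rule tendsto_mult_right_zero)
  then have "(hermite_potential \<alpha> i \<longlongrightarrow> 0) (at (0 :: real^'d))"
    by (rule Lim_null_comparison[rotated]) (use bound in auto)
  then show ?thesis using True by (simp add: isCont_def hermite_potential_def)
qed

lemma continuous_on_hermite_potential:
  "\<alpha> > 0 \<Longrightarrow> continuous_on S (hermite_potential \<alpha> i :: real^'d::finite \<Rightarrow> real)"
  using isCont_hermite_potential by (blast intro: continuous_at_imp_continuous_on)

lemma hermite_div_scaleR:
  assumes "C1_map \<xi>" "C1_map \<phi>"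
  shows "hermite_div \<alpha> (\<lambda>x. \<xi> x *\<^sub>R \<phi> x) x =
    \<xi> x * hermite_div \<alpha> \<phi> x + (\<Sum>i\<in>UNIV. partial_deriv i \<xi> x * (\<phi> x $ Inl i + \<phi> x $ Inr i))"
  by (simp add: hermite_div_def hermite_A_plus_def hermite_A_minus_def
      partial_deriv_mult[OF assms(1) C1_map_nth[OF assms(2)]]
      sum.distrib sum_subtractf sum_distrib_left algebra_simps)

lemma hermite_div_add:
  assumes "C1_map \<phi>" "C1_map \<psi>"
  shows "hermite_div \<alpha> (\<lambda>x. \<phi> x + \<psi> x) x = hermite_div \<alpha> \<phi> x + hermite_div \<alpha> \<psi> x"
  by (simp add: hermite_div_def hermite_A_plus_def hermite_A_minus_def
      partial_deriv_add[OF C1_map_nth[OF assms(1)] C1_map_nth[OF assms(2)]]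
      sum.distrib sum_subtractf algebra_simps)

lemma hermite_div_diff:
  assumes "C1_map \<phi>" "C1_map \<psi>"
  shows "hermite_div \<alpha> (\<lambda>x. \<phi> x - \<psi> x) x = hermite_div \<alpha> \<phi> x - hermite_div \<alpha> \<psi> x"
  using hermite_div_add[OF assms(1) C1_map_scaleR[OF C1_map_const[of "-1"] assms(2)], of \<alpha> x]
  by (simp only: hermite_div_scaleR[OF C1_map_const assms(2)]) (simp add: partial_deriv_const)

text \<open>The operator commutes with translations except for the increments of the potential.\<close>

lemma hermite_div_shift:
  "hermite_div \<alpha> (\<lambda>x. \<phi> (x + y)) x = hermite_div \<alpha> \<phi> (x + y) +
    (\<Sum>i\<in>UNIV. (hermite_potential \<alpha> i x - hermite_potential \<alpha> i (x + y)) *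
       (\<phi> (x + y) $ Inl i - \<phi> (x + y) $ Inr i))"
  by (simp add: hermite_div_def hermite_A_plus_def hermite_A_minus_def
      partial_deriv_shift[of _ "\<lambda>x. \<phi> x $ j" for j] sum.distrib sum_subtractf algebra_simps)

lemma continuous_on_hermite_div:
  assumes "C1_map \<phi>" "\<alpha> > 0" shows "continuous_on S (hermite_div \<alpha> \<phi>)"
proof -
  have "continuous_on S (\<lambda>x. hermite_div \<alpha> \<phi> x)"
    unfolding hermite_div_def hermite_A_plus_def hermite_A_minus_def
    by (intro continuous_intros continuous_on_partial_deriv C1_map_nth C1_map_continuous_on
        continuous_on_hermite_potential assms)
  then show ?thesis .
qed

lemma hermite_div_eq_0:
  assumes "closed K" "x \<notin> K" "\<And>x. x \<notin> K \<Longrightarrow> \<phi> x = 0"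
  shows "hermite_div \<alpha> \<phi> x = 0"
  using assms(2,3)
  by (simp add: hermite_div_def hermite_A_plus_def hermite_A_minus_def
      partial_deriv_eq_0[OF assms(1), of x "\<lambda>x. \<phi> x $ j" for j])

lemma test_fieldsI:
  assumes "C1_map \<phi>" "compact K" "\<And>x. x \<notin> K \<Longrightarrow> \<phi> x = 0" "\<And>x. norm (\<phi> x) \<le> 1"
  shows "\<phi> \<in> test_fields"
proof -
  have "closure {x. \<phi> x \<noteq> 0} \<subseteq> K"
    using assms(2,3) by (intro closure_minimal compact_imp_closed) auto
  then have "compact (closure {x. \<phi> x \<noteq> 0})"
    using assms(2) closed_closure compact_Int_closed by (metis inf.absorb_iff2)
  then show ?thesis using assms by (simp add: test_fields_def)
qed

lemma test_fieldsE:
  assumes "\<phi> \<in> test_fields"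
  obtains K where "C1_map \<phi>" "compact K" "\<And>x. x \<notin> K \<Longrightarrow> \<phi> x = 0" "\<And>x. norm (\<phi> x) \<le> 1"
proof (rule that[of "closure {x. \<phi> x \<noteq> 0}"])
  show "\<phi> x = 0" if "x \<notin> closure {x. \<phi> x \<noteq> 0}" for x
    using that closure_subset[of "{x. \<phi> x \<noteq> 0}"] by blast
qed (use assms in \<open>auto simp: test_fields_def\<close>)

lemma zero_test_field: "(\<lambda>x. 0) \<in> test_fields"
  by (rule test_fieldsI[of _ "{}"]) (auto simp: C1_map_const)

lemma hermite_div_zero: "hermite_div \<alpha> (\<lambda>x. 0) x = 0"
  by (rule hermite_div_eq_0[of "{}"]) auto

lemma test_field_component_bound: "\<phi> \<in> test_fields \<Longrightarrow> \<bar>\<phi> x $ j\<bar> \<le> 1"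
  using component_le_norm_cart[of "\<phi> x" j] unfolding test_fields_def
  by (auto intro: order_trans)

lemma hermite_div_test_field:
  assumes "\<phi> \<in> test_fields" "\<alpha> > 0"
  shows "hermite_div \<alpha> \<phi> \<in> borel_measurable borel"
    and "integrable lborel (hermite_div \<alpha> \<phi>)"
    and "\<exists>M>0. \<forall>x. \<bar>hermite_div \<alpha> \<phi> x\<bar> \<le> M"
proof -
  obtain K where K: "C1_map \<phi>" "compact K" "\<And>x. x \<notin> K \<Longrightarrow> \<phi> x = 0"
    using assms(1) by (rule test_fieldsE) blast
  have cont: "continuous_on UNIV (hermite_div \<alpha> \<phi>)"
    using K(1) assms(2) by (rule continuous_on_hermite_div)
  have zero: "hermite_div \<alpha> \<phi> x = 0" if "x \<notin> K" for x
    using compact_imp_closed[OF K(2)] that K(3) by (rule hermite_div_eq_0)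
  show "hermite_div \<alpha> \<phi> \<in> borel_measurable borel"
    using cont by (rule borel_measurable_continuous_onI)
  show "integrable lborel (hermite_div \<alpha> \<phi>)"
    using cont K(2) zero by (rule integrable_continuous_compact_support)
  show "\<exists>M>0. \<forall>x. \<bar>hermite_div \<alpha> \<phi> x\<bar> \<le> M"
    using bounded_continuous_compact_support[OF cont K(2) zero] by metis
qed

lemma integrable_mult_bounded:
  fixes f w :: "'a \<Rightarrow> real"
  assumes f: "integrable M f" and w: "w \<in> borel_measurable M" "\<And>x. \<bar>w x\<bar> \<le> B"
  shows "integrable M (\<lambda>x. f x * w x)"
proof (rule Bochner_Integration.integrable_bound)
  show "integrable M (\<lambda>x. B * f x)" using f by simp
  show "AE x in M. norm (f x * w x) \<le> norm (B * f x)"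
    using w(2) by (auto simp: abs_mult mult.commute[of B] intro!: mult_left_mono order_trans[OF w(2)])
  show "(\<lambda>x. f x * w x) \<in> borel_measurable M" using f w(1) by measurable
qed

lemma integrable_mult_hermite_div:
  assumes "integrable lborel f" "\<phi> \<in> test_fields" "\<alpha> > 0"
  shows "integrable lborel (\<lambda>x. f x * hermite_div \<alpha> \<phi> x)"
proof -
  obtain M where "\<forall>x. \<bar>hermite_div \<alpha> \<phi> x\<bar> \<le> M"
    using hermite_div_test_field(3)[OF assms(2,3)] by blast
  then show ?thesis
    using hermite_div_test_field(1)[OF assms(2,3)] by (intro integrable_mult_bounded[OF assms(1)]) auto
qed

lemma integral_hermite_div_lebesgue:
  assumes "f \<in> borel_measurable borel" "\<phi> \<in> test_fields" "\<alpha> > 0"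
  shows "(LINT x|lebesgue. f x * hermite_div \<alpha> \<phi> x) = (LINT x|lborel. f x * hermite_div \<alpha> \<phi> x)"
  using assms(1) hermite_div_test_field(1)[OF assms(2,3)] by (intro integral_completion) simp

lemma integral_le_hermite_variation:
  assumes "f \<in> borel_measurable borel" "\<phi> \<in> test_fields" "\<alpha> > 0"
  shows "ereal (LINT x|lborel. f x * hermite_div \<alpha> \<phi> x) \<le> hermite_variation \<alpha> f"
  unfolding hermite_variation_def integral_hermite_div_lebesgue[OF assms, symmetric]
  using assms(2) by (rule SUP_upper)

lemma hermite_variation_leI:
  assumes "f \<in> borel_measurable borel" "\<alpha> > 0"
    and "\<And>\<phi>. \<phi> \<in> test_fields \<Longrightarrow> ereal (LINT x|lborel. f x * hermite_div \<alpha> \<phi> x) \<le> c"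
  shows "hermite_variation \<alpha> f \<le> c"
  unfolding hermite_variation_def
  by (rule SUP_least) (simp add: integral_hermite_div_lebesgue assms)

lemma hermite_variation_nonneg: "0 \<le> hermite_variation \<alpha> f"
  unfolding hermite_variation_def
  using SUP_upper[OF zero_test_field, of "\<lambda>\<phi>. ereal (LINT x|lebesgue. f x * hermite_div \<alpha> \<phi> x)"]
  by (simp add: hermite_div_zero zero_ereal_def[symmetric])

lemma hermite_variation_zero: "hermite_variation \<alpha> (\<lambda>x. 0) = 0"
  using zero_test_field by (auto simp: hermite_variation_def zero_ereal_def[symmetric] intro!: SUP_eqI)

lemma hermite_variation_cong_AE:
  assumes "AE x in lebesgue. f x = g x" "\<alpha> > 0" "f \<in> borel_measurable lebesgue" "g \<in> borel_measurable lebesgue"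
  shows "hermite_variation \<alpha> f = hermite_variation \<alpha> g"
  unfolding hermite_variation_def
proof (intro SUP_cong refl arg_cong[where f = ereal] integral_cong_AE)
  fix \<phi> :: "real^'a \<Rightarrow> real^('a + 'a)" assume "\<phi> \<in> test_fields"
  then have [measurable]: "hermite_div \<alpha> \<phi> \<in> borel_measurable lebesgue"
    using hermite_div_test_field(1)[OF _ assms(2)] by (intro measurable_completion) simp
  note [measurable] = assms(3,4)
  show "(\<lambda>x. f x * hermite_div \<alpha> \<phi> x) \<in> borel_measurable lebesgue" by measurable
  show "(\<lambda>x. g x * hermite_div \<alpha> \<phi> x) \<in> borel_measurable lebesgue" by measurable
  show "AE x in lebesgue. f x * hermite_div \<alpha> \<phi> x = g x * hermite_div \<alpha> \<phi> x"
    using assms(1) by auto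
qed

section \<open>Submodularity for continuously differentiable functions\<close>

text \<open>\<open>H\<close> is a smoothed Heaviside function of width \<open>\<delta>\<close> with derivative \<open>H'\<close>, and \<open>G\<close> is the primitive of
  \<open>t H'(t)\<close> that vanishes at infinity. This algebraic profile has all of these in closed form, and
  the errors \<open>G\<close> and \<open>t H(t) - max t 0\<close> are bounded uniformly in \<open>t\<close>.\<close>

lemma smooth_step:
  fixes \<delta> t :: real
  assumes "\<delta> > 0"
  defines "H \<equiv> \<lambda>t. (1 + t / sqrt (t\<^sup>2 + \<delta>\<^sup>2)) / 2"
    and "H' \<equiv> \<lambda>t. \<delta>\<^sup>2 / (2 * (t\<^sup>2 + \<delta>\<^sup>2) * sqrt (t\<^sup>2 + \<delta>\<^sup>2))"
    and "G \<equiv> \<lambda>t. - \<delta>\<^sup>2 / (2 * sqrt (t\<^sup>2 + \<delta>\<^sup>2))"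
  shows "(H has_real_derivative H' t) (at t)" "(G has_real_derivative t * H' t) (at t)"
    and "continuous_on UNIV H'" "0 \<le> H t" "H t \<le> 1" "\<bar>G t\<bar> \<le> \<delta>" "\<bar>t * H t - max t 0\<bar> \<le> \<delta>"
proof -
  have pos: "s\<^sup>2 + \<delta>\<^sup>2 > 0" for s using assms(1) by (simp add: add_nonneg_pos)
  have spos: "sqrt (s\<^sup>2 + \<delta>\<^sup>2) > 0" for s using pos by simp
  have sq: "sqrt (s\<^sup>2 + \<delta>\<^sup>2) * sqrt (s\<^sup>2 + \<delta>\<^sup>2) = s\<^sup>2 + \<delta>\<^sup>2" for s
    using pos[of s] by simp
  have t_le: "\<bar>t\<bar> \<le> sqrt (t\<^sup>2 + \<delta>\<^sup>2)"
    by (rule real_le_rsqrt) simp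
  have d_le: "\<delta> \<le> sqrt (t\<^sup>2 + \<delta>\<^sup>2)"
    by (rule real_le_rsqrt) simp
  define r where "r = sqrt (t\<^sup>2 + \<delta>\<^sup>2)"
  have r: "r > 0" "r * r = t\<^sup>2 + \<delta>\<^sup>2" "\<bar>t\<bar> \<le> r" "\<delta> \<le> r"
    using spos sq t_le d_le by (auto simp: r_def)
  have d\<delta>: "\<delta> * \<delta> = r * r - t * t" using r(2) by (simp add: power2_eq_square)
  have dr: "((\<lambda>t. sqrt (t\<^sup>2 + \<delta>\<^sup>2)) has_real_derivative t / r) (at t)"
    unfolding r_def using pos[of t]
    by (auto intro!: derivative_eq_intros simp: field_simps)
  have H'_r: "H' t = \<delta> * \<delta> / (2 * (r * r) * r)"
    unfolding H'_def r_def[symmetric] r(2)[symmetric] using r(1) by (simp add: power2_eq_square)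
  show "(H has_real_derivative H' t) (at t)"
  proof -
    have "((\<lambda>t. t / sqrt (t\<^sup>2 + \<delta>\<^sup>2)) has_real_derivative (1 * r - t * (t / r)) / (r * r)) (at t)"
      unfolding r_def by (rule DERIV_divide[OF DERIV_ident dr[unfolded r_def]]) (use assms(1) in simp)
    then have "(H has_real_derivative (0 + (1 * r - t * (t / r)) / (r * r)) / 2) (at t)"
      unfolding H_def by (rule DERIV_cdivide[OF DERIV_add[OF DERIV_const]])
    moreover have "(0 + (1 * r - t * (t / r)) / (r * r)) / 2 = H' t"
      unfolding H'_r d\<delta> using r(1) by (simp add: field_simps)
    ultimately show ?thesis by simp
  qed
  show "(G has_real_derivative t * H' t) (at t)"
  proof -
    have "((\<lambda>t. inverse (sqrt (t\<^sup>2 + \<delta>\<^sup>2))) has_real_derivative - (inverse r * (t / r) * inverse r)) (at t)"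
      unfolding r_def by (rule DERIV_inverse'[OF dr[unfolded r_def]]) (use assms(1) in simp)
    then have "((\<lambda>t. - \<delta>\<^sup>2 / 2 * inverse (sqrt (t\<^sup>2 + \<delta>\<^sup>2))) has_real_derivative
        - \<delta>\<^sup>2 / 2 * - (inverse r * (t / r) * inverse r)) (at t)"
      by (rule DERIV_cmult)
    moreover have "- \<delta>\<^sup>2 / 2 * - (inverse r * (t / r) * inverse r) = t * H' t"
      unfolding H'_r using r(1) by (simp add: field_simps power2_eq_square)
    moreover have "(\<lambda>t. - \<delta>\<^sup>2 / 2 * inverse (sqrt (t\<^sup>2 + \<delta>\<^sup>2))) = G"
      by (simp add: G_def field_simps)
    ultimately show ?thesis by simp
  qed
  show "continuous_on UNIV H'"
  proof -
    have "2 * (s\<^sup>2 + \<delta>\<^sup>2) * sqrt (s\<^sup>2 + \<delta>\<^sup>2) \<noteq> 0" for s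
    proof -
      have "2 * (s\<^sup>2 + \<delta>\<^sup>2) * sqrt (s\<^sup>2 + \<delta>\<^sup>2) > 0"
        using pos[of s] spos[of s] by (intro mult_pos_pos) auto
      then show ?thesis by (rule less_imp_neq[symmetric])
    qed
    then show ?thesis unfolding H'_def by (intro continuous_intros) auto
  qed
  have "\<bar>t / r\<bar> \<le> 1" using r by (simp add: abs_divide)
  then have "- 1 \<le> t / r" "t / r \<le> 1" unfolding abs_le_iff by linarith+
  then show "0 \<le> H t" "H t \<le> 1" by (simp_all add: H_def r_def[symmetric])
  have "\<delta>\<^sup>2 / (2 * r) \<le> \<delta>"
    using r assms(1) by (simp add: field_simps power2_eq_square)
  then show "\<bar>G t\<bar> \<le> \<delta>" using r by (simp add: G_def r_def[symmetric])
  have "t * H t - max t 0 = (t * t / r - \<bar>t\<bar>) / 2"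
    unfolding H_def r_def[symmetric] by (simp add: max_def field_simps)
  moreover have "\<bar>t * t / r - \<bar>t\<bar>\<bar> \<le> \<delta>"
  proof -
    have "t * t \<le> r * \<bar>t\<bar>" using mult_right_mono[OF r(3), of "\<bar>t\<bar>"] by simp
    then have "t * t / r \<le> \<bar>t\<bar>" using r by (simp add: field_simps)
    moreover have "(r - \<delta>) * (r - \<delta>) \<le> (r - \<delta>) * (r + \<delta>)"
      using r assms(1) by (intro mult_left_mono) auto
    then have "(r - \<delta>)\<^sup>2 \<le> t\<^sup>2" using d\<delta> by (simp add: algebra_simps power2_eq_square)
    then have "r - \<delta> \<le> \<bar>t\<bar>" using power2_le_imp_le[of "r - \<delta>" "\<bar>t\<bar>"] by simp
    then have "\<bar>t\<bar> * r \<le> t * t + \<delta> * r"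
    proof -
      have "\<bar>t\<bar> * (r - \<bar>t\<bar>) \<le> r * \<delta>"
        using r \<open>r - \<delta> \<le> \<bar>t\<bar>\<close> by (intro mult_mono) auto
      then show ?thesis by (simp add: algebra_simps)
    qed
    then have "\<bar>t\<bar> - t * t / r \<le> \<delta>" using r by (simp add: field_simps)
    ultimately show ?thesis by simp
  qed
  ultimately show "\<bar>t * H t - max t 0\<bar> \<le> \<delta>" by simp
qed

text \<open>For given fields \<open>\<phi>\<close> and \<open>\<psi>\<close>, testing \<open>f\<close> with \<open>\<phi>\<close> where \<open>f > g\<close> and with \<open>\<psi>\<close> elsewhere,
  and \<open>g\<close> the other way round, would give the inequality at once. The switch is made continuously
  differentiable by a smooth step \<open>H\<close> of \<open>h = f - g\<close>. The error from differentiating it is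
  \<open>h H'(h) \<nabla>h = \<nabla>(G \<circ> h)\<close> with \<open>G\<close> uniformly small, and integration by parts moves the
  derivative onto the fields.\<close>

lemma smooth_submodular_duality:
  fixes f g :: "real^'d::finite \<Rightarrow> real"
  assumes f: "C1_map f" and g: "C1_map g" and \<phi>: "\<phi> \<in> test_fields" and \<psi>: "\<psi> \<in> test_fields"
    and \<alpha>: "\<alpha> > 0"
  shows "ereal ((LINT x|lborel. max (f x) (g x) * hermite_div \<alpha> \<phi> x) +
                (LINT x|lborel. min (f x) (g x) * hermite_div \<alpha> \<psi> x))
         \<le> hermite_variation \<alpha> f + hermite_variation \<alpha> g"
proof -
  obtain K1 where K1: "C1_map \<phi>" "compact K1" "\<And>x. x \<notin> K1 \<Longrightarrow> \<phi> x = 0" "\<And>x. norm (\<phi> x) \<le> 1"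
    using \<phi> by (rule test_fieldsE) blast
  obtain K2 where K2: "C1_map \<psi>" "compact K2" "\<And>x. x \<notin> K2 \<Longrightarrow> \<psi> x = 0" "\<And>x. norm (\<psi> x) \<le> 1"
    using \<psi> by (rule test_fieldsE) blast
  define K where "K = K1 \<union> K2"
  have \<phi>0: "\<phi> x = 0" and \<psi>0: "\<psi> x = 0" if "x \<notin> K" for x
    using K1(3) K2(3) that by (auto simp: K_def)
  have K: "compact K" "closed K"
    using K1 K2 by (auto simp: K_def intro: compact_imp_closed)
  define h where "h x = f x - g x" for x
  have h: "C1_map h" unfolding h_def using f g by (rule C1_map_diff)
  define \<theta> where "\<theta> x = \<phi> x - \<psi> x" for x
  have \<theta>: "C1_map \<theta>" unfolding \<theta>_def using K1(1) K2(1) by (rule C1_map_diff)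
  have D\<theta>: "hermite_div \<alpha> \<theta> x = hermite_div \<alpha> \<phi> x - hermite_div \<alpha> \<psi> x" for x
    unfolding \<theta>_def using K1(1) K2(1) by (rule hermite_div_diff)
  define s where "s i x = \<theta> x $ Inl i + \<theta> x $ Inr i" for i x
  have s: "C1_map (s i)" for i unfolding s_def by (intro C1_map_add C1_map_nth \<theta>)
  have s0: "s i x = 0" if "x \<notin> K" for i x
    using \<phi>0[OF that] \<psi>0[OF that] by (simp add: s_def \<theta>_def)
  have ds0: "partial_deriv i (s i) x = 0" if "x \<notin> K" for i x
    using K(2) that s0 by (rule partial_deriv_eq_0)
  have int_ds: "integrable lborel (partial_deriv i (s i))" for i
    by (rule integrable_continuous_compact_support[OF continuous_on_partial_deriv[OF s] K(1) ds0])
  have int: "integrable lborel (\<lambda>x. u x * hermite_div \<alpha> \<eta> x)"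
    if u: "continuous_on UNIV u" and \<eta>: "\<eta> \<in> test_fields" for u and \<eta> :: "real^'d \<Rightarrow> real^('d+'d)"
  proof -
    obtain L where L: "C1_map \<eta>" "compact L" "\<And>x. x \<notin> L \<Longrightarrow> \<eta> x = 0"
      using \<eta> by (rule test_fieldsE) blast
    show ?thesis
      by (rule integrable_continuous_compact_support[OF _ L(2)])
         (auto intro!: continuous_intros u continuous_on_hermite_div[OF L(1) \<alpha>]
            simp: hermite_div_eq_0[OF compact_imp_closed[OF L(2)] _ L(3)])
  qed
  have cf: "continuous_on UNIV f" and cg: "continuous_on UNIV g"
    using f g by (auto intro: C1_map_continuous_on)
  define A where "A = (LINT x|lborel. max (f x) (g x) * hermite_div \<alpha> \<phi> x) +
                      (LINT x|lborel. min (f x) (g x) * hermite_div \<alpha> \<psi> x)"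
  \<comment> \<open>the error density is independent of the width \<open>\<delta>\<close> of the step\<close>
  define E where "E x = \<bar>hermite_div \<alpha> \<phi> x\<bar> + \<bar>hermite_div \<alpha> \<psi> x\<bar> +
                        (\<Sum>i\<in>UNIV. \<bar>partial_deriv i (s i) x\<bar>)" for x
  have int_E: "integrable lborel E"
    unfolding E_def using hermite_div_test_field(2)[OF \<phi> \<alpha>] hermite_div_test_field(2)[OF \<psi> \<alpha>] int_ds
    by (intro Bochner_Integration.integrable_add Bochner_Integration.integrable_sum integrable_abs) auto
  define C where "C = (LINT x|lborel. E x)"
  have "C \<ge> 0"
    unfolding C_def E_def by (intro Bochner_Integration.integral_nonneg) (auto intro: sum_nonneg)
  have key: "ereal A \<le> hermite_variation \<alpha> f + hermite_variation \<alpha> g + ereal (\<delta> * C)" if "\<delta> > 0" for \<delta>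
  proof -
    define H where "H t = (1 + t / sqrt (t\<^sup>2 + \<delta>\<^sup>2)) / 2" for t
    define H' where "H' t = \<delta>\<^sup>2 / (2 * (t\<^sup>2 + \<delta>\<^sup>2) * sqrt (t\<^sup>2 + \<delta>\<^sup>2))" for t
    define G where "G t = - \<delta>\<^sup>2 / (2 * sqrt (t\<^sup>2 + \<delta>\<^sup>2))" for t
    note step = smooth_step[OF that, folded H_def H'_def G_def]
    define \<xi> where "\<xi> x = H (h x)" for x
    have \<xi>: "C1_map \<xi>" unfolding \<xi>_def using h step(1,3) by (rule C1_map_compose_real)
    have \<xi>01: "0 \<le> \<xi> x" "\<xi> x \<le> 1" for x using step(4,5) by (auto simp: \<xi>_def)
    have d\<xi>: "partial_deriv i \<xi> x = H' (h x) * partial_deriv i h x" for i x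
      unfolding \<xi>_def using h step(1) by (rule partial_deriv_compose_real)
    have Gh: "C1_map (\<lambda>x. G (h x))"
      using h step(2) by (rule C1_map_compose_real) (intro continuous_intros step(3))
    have dGh: "partial_deriv i (\<lambda>x. G (h x)) x = h x * H' (h x) * partial_deriv i h x" for i x
      using h step(2) by (rule partial_deriv_compose_real)
    \<comment> \<open>\<open>\<partial>\<^sub>iw\<^sub>i\<close> contains the term \<open>h H'(h) \<partial>\<^sub>ih s\<^sub>i\<close> that arises when \<open>\<xi>\<close> is differentiated, and integrates to zero\<close>
    define w where "w i x = G (h x) * s i x" for i x
    have w: "C1_map (w i)" for i unfolding w_def by (intro C1_map_mult Gh s)
    have w0: "w i x = 0" if "x \<notin> K" for i x using s0[OF that] by (simp add: w_def)
    have dw: "partial_deriv i (w i) x =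
        G (h x) * partial_deriv i (s i) x + h x * H' (h x) * partial_deriv i h x * s i x" for i x
      unfolding w_def partial_deriv_mult[OF Gh s] dGh ..
    have dw0: "partial_deriv i (w i) x = 0" if "x \<notin> K" for i x
      using K(2) that w0 by (rule partial_deriv_eq_0)
    have int_dw: "integrable lborel (partial_deriv i (w i))" for i
      by (rule integrable_continuous_compact_support[OF continuous_on_partial_deriv[OF w] K(1) dw0])
    have w_int0: "(LINT x|lborel. partial_deriv i (w i) x) = 0" for i
      using w K(1) w0 by (rule integral_partial_deriv_eq_0)

    define W where "W x = (\<Sum>i\<in>UNIV. partial_deriv i (w i) x)" for x
    have int_W: "integrable lborel W"
      unfolding W_def using int_dw by (intro Bochner_Integration.integrable_sum)
    have W_int0: "(LINT x|lborel. W x) = 0"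
      unfolding W_def using int_dw by (subst Bochner_Integration.integral_sum) (auto simp: w_int0)

    \<comment> \<open>these are the convex combinations \<open>\<xi> \<phi> + (1 - \<xi>) \<psi>\<close> and \<open>\<xi> \<psi> + (1 - \<xi>) \<phi>\<close>, hence test fields\<close>
    define \<eta>1 where "\<eta>1 x = \<psi> x + \<xi> x *\<^sub>R \<theta> x" for x
    define \<eta>2 where "\<eta>2 x = \<phi> x - \<xi> x *\<^sub>R \<theta> x" for x
    have convex: "norm (c *\<^sub>R a + (1 - c) *\<^sub>R b) \<le> 1"
      if "0 \<le> c" "c \<le> 1" "norm a \<le> 1" "norm b \<le> 1" for c :: real and a b :: "real^('d + 'd)"
      using convexD[OF convex_cball[of 0 1], of a b c "1 - c"] that by simp
    have \<eta>1: "\<eta>1 \<in> test_fields"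
    proof (rule test_fieldsI[OF _ K(1)])
      show "C1_map \<eta>1" unfolding \<eta>1_def by (intro C1_map_add C1_map_scaleR K2 \<xi> \<theta>)
      show "\<eta>1 x = 0" if "x \<notin> K" for x using \<phi>0[OF that] \<psi>0[OF that] by (simp add: \<eta>1_def \<theta>_def)
      show "norm (\<eta>1 x) \<le> 1" for x
        using convex[OF \<xi>01 K1(4) K2(4), of x x x] by (simp add: \<eta>1_def \<theta>_def algebra_simps)
    qed
    have \<eta>2: "\<eta>2 \<in> test_fields"
    proof (rule test_fieldsI[OF _ K(1)])
      show "C1_map \<eta>2" unfolding \<eta>2_def by (intro C1_map_diff C1_map_scaleR K1 \<xi> \<theta>)
      show "\<eta>2 x = 0" if "x \<notin> K" for x using \<phi>0[OF that] \<psi>0[OF that] by (simp add: \<eta>2_def \<theta>_def)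
      show "norm (\<eta>2 x) \<le> 1" for x
        using convex[OF \<xi>01 K2(4) K1(4), of x x x] by (simp add: \<eta>2_def \<theta>_def algebra_simps)
    qed
    have D\<eta>1: "hermite_div \<alpha> \<eta>1 x = hermite_div \<alpha> \<psi> x +
        \<xi> x * hermite_div \<alpha> \<theta> x + (\<Sum>i\<in>UNIV. partial_deriv i \<xi> x * s i x)" for x
      unfolding \<eta>1_def hermite_div_add[OF K2(1) C1_map_scaleR[OF \<xi> \<theta>]] hermite_div_scaleR[OF \<xi> \<theta>] s_def by simp
    have D\<eta>2: "hermite_div \<alpha> \<eta>2 x = hermite_div \<alpha> \<phi> x -
        \<xi> x * hermite_div \<alpha> \<theta> x - (\<Sum>i\<in>UNIV. partial_deriv i \<xi> x * s i x)" for x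
      unfolding \<eta>2_def hermite_div_diff[OF K1(1) C1_map_scaleR[OF \<xi> \<theta>]] hermite_div_scaleR[OF \<xi> \<theta>] s_def by simp

    have pointwise: "max (f x) (g x) * hermite_div \<alpha> \<phi> x + min (f x) (g x) * hermite_div \<alpha> \<psi> x
        \<le> f x * hermite_div \<alpha> \<eta>1 x + g x * hermite_div \<alpha> \<eta>2 x
          + \<delta> * E x - W x" for x
    proof -
      let ?p = "hermite_div \<alpha> \<phi> x" and ?q = "hermite_div \<alpha> \<psi> x"
      have "W x =
          (\<Sum>i\<in>UNIV. G (h x) * partial_deriv i (s i) x) + h x * (\<Sum>i\<in>UNIV. partial_deriv i \<xi> x * s i x)"
        by (simp add: W_def dw d\<xi> sum.distrib sum_distrib_left mult_ac)
      moreover have "(\<Sum>i\<in>UNIV. G (h x) * partial_deriv i (s i) x) \<le> (\<Sum>i\<in>UNIV. \<delta> * \<bar>partial_deriv i (s i) x\<bar>)"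
        using mult_right_mono[OF step(6)[of "h x"] abs_ge_zero]
        by (intro sum_mono) (metis abs_ge_self abs_mult order_trans)
      moreover have "(max (h x) 0 - h x * \<xi> x) * (?p - ?q) \<le> \<delta> * (\<bar>?p\<bar> + \<bar>?q\<bar>)"
      proof -
        have "(max (h x) 0 - h x * \<xi> x) * (?p - ?q) \<le> \<bar>max (h x) 0 - h x * \<xi> x\<bar> * \<bar>?p - ?q\<bar>"
          by (metis abs_ge_self abs_mult)
        also have "\<dots> \<le> \<delta> * (\<bar>?p\<bar> + \<bar>?q\<bar>)"
          using step(7)[of "h x"] that by (intro mult_mono) (auto simp: \<xi>_def)
        finally show ?thesis .
      qed
      moreover have "max (f x) (g x) * ?p + min (f x) (g x) * ?q =
          g x * ?p + f x * ?q + max (h x) 0 * (?p - ?q)"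
      proof -
        have eq: "max (f x) (g x) = g x + max (h x) 0" "min (f x) (g x) = f x - max (h x) 0"
          by (auto simp: h_def)
        show ?thesis unfolding eq by (simp add: algebra_simps)
      qed
      moreover have "f x * hermite_div \<alpha> \<eta>1 x + g x * hermite_div \<alpha> \<eta>2 x =
          f x * ?q + g x * ?p + h x * \<xi> x * (?p - ?q) + h x * (\<Sum>i\<in>UNIV. partial_deriv i \<xi> x * s i x)"
        unfolding D\<eta>1 D\<eta>2 D\<theta> h_def by (simp add: algebra_simps)
      ultimately show ?thesis
        unfolding E_def sum_distrib_left[symmetric] left_diff_distrib by (simp add: distrib_left)
    qed
    note ints = int[OF continuous_on_max[OF cf cg] \<phi>] int[OF continuous_on_min[OF cf cg] \<psi>]
      int[OF cf \<eta>1] int[OF cg \<eta>2]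
    have "A = (LINT x|lborel. max (f x) (g x) * hermite_div \<alpha> \<phi> x + min (f x) (g x) * hermite_div \<alpha> \<psi> x)"
      unfolding A_def using ints by simp
    also have "\<dots> \<le> (LINT x|lborel. f x * hermite_div \<alpha> \<eta>1 x + g x * hermite_div \<alpha> \<eta>2 x
          + \<delta> * E x - W x)"
      using ints int_E int_W pointwise
      by (intro integral_mono Bochner_Integration.integrable_add Bochner_Integration.integrable_diff
          integrable_mult_right)
    also have "\<dots> = (LINT x|lborel. f x * hermite_div \<alpha> \<eta>1 x) + (LINT x|lborel. g x * hermite_div \<alpha> \<eta>2 x) + \<delta> * C"
      unfolding C_def using ints(3,4) int_E int_W W_int0 by simp
    finally have "ereal A \<le> ereal (LINT x|lborel. f x * hermite_div \<alpha> \<eta>1 x) +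
        ereal (LINT x|lborel. g x * hermite_div \<alpha> \<eta>2 x) + ereal (\<delta> * C)" by simp
    also have "\<dots> \<le> hermite_variation \<alpha> f + hermite_variation \<alpha> g + ereal (\<delta> * C)"
      using \<eta>1 \<eta>2 \<alpha> cf cg
      by (intro add_mono integral_le_hermite_variation order_refl borel_measurable_continuous_onI)
    finally show ?thesis .
  qed
  have "ereal A \<le> hermite_variation \<alpha> f + hermite_variation \<alpha> g"
  proof (rule ereal_le_epsilon2)
    fix e :: real assume "e > 0"
    then have "e / (C + 1) * C \<le> e" "e / (C + 1) > 0"
      using \<open>C \<ge> 0\<close> by (auto simp: field_simps)
    then show "ereal A \<le> hermite_variation \<alpha> f + hermite_variation \<alpha> g + ereal e"
      using key[of "e / (C + 1)"] by (meson add_left_mono ereal_less_eq(3) order_trans)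
  qed
  then show ?thesis unfolding A_def .
qed

section \<open>Cut-off functions and mollifiers\<close>

text \<open>The square of the positive part is just smooth enough to be continuously differentiable. After
  scaling, this one function serves both as a cut-off and as a mollifier.\<close>

definition bump :: "'a::euclidean_space \<Rightarrow> real" where
  "bump x = (max 0 (1 - x \<bullet> x))\<^sup>2"

lemma DERIV_max_0_power2: "((\<lambda>s. (max 0 s)\<^sup>2) has_real_derivative 2 * max 0 s) (at s)"
proof -
  consider "s > 0" | "s < 0" | "s = 0" by linarith
  then show ?thesis
  proof cases
    case 1
    have "((\<lambda>s. s\<^sup>2) has_real_derivative 2 * max 0 s) (at s)"
      using 1 by (auto intro!: derivative_eq_intros)
    then show ?thesis
      by (rule has_field_derivative_transform_within_open[of _ _ _ "{0<..}"]) (use 1 in auto)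
  next
    case 2
    have "((\<lambda>s. 0) has_real_derivative 2 * max 0 s) (at s)"
      using 2 by (auto intro!: derivative_eq_intros)
    then show ?thesis
      by (rule has_field_derivative_transform_within_open[of _ _ _ "{..<0}"]) (use 2 in auto)
  next
    case 3
    have "((\<lambda>h. ((max 0 (0 + h))\<^sup>2 - (max 0 0)\<^sup>2) / h) \<longlongrightarrow> (0::real)) (at 0)"
    proof (rule Lim_null_comparison)
      have "norm (((max 0 (0 + h))\<^sup>2 - (max 0 0)\<^sup>2) / h) \<le> \<bar>h\<bar>" for h :: real
        by (cases "h > 0") (auto simp: power2_eq_square max_def)
      then show "\<forall>\<^sub>F h in at 0. norm (((max 0 (0 + h))\<^sup>2 - (max 0 0)\<^sup>2) / h) \<le> \<bar>h :: real\<bar>" by simp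
      show "(abs \<longlongrightarrow> (0::real)) (at 0)" by (intro tendsto_rabs_zero tendsto_ident_at)
    qed
    then show ?thesis using 3 by (simp add: DERIV_def)
  qed
qed

lemma has_derivative_inner_self: "((\<lambda>x. x \<bullet> x) has_derivative (\<lambda>v. 2 * (x \<bullet> v))) (at x)"
  by (auto intro!: derivative_eq_intros simp: inner_commute)

lemma C1_map_inner_self: "C1_map (\<lambda>x::'a::euclidean_space. x \<bullet> x)"
  by (rule C1_mapI[OF has_derivative_inner_self]) (intro continuous_intros)

lemma DERIV_bump_profile: "((\<lambda>t. (max 0 (1 - t))\<^sup>2) has_real_derivative - 2 * max 0 (1 - t)) (at t)"
proof -
  have "((\<lambda>t. 1 - t) has_real_derivative - 1) (at t)" by (auto intro!: derivative_eq_intros)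
  from DERIV_chain2[OF DERIV_max_0_power2 this] show ?thesis by simp
qed

lemma C1_map_bump: "C1_map (bump :: 'a::euclidean_space \<Rightarrow> real)"
proof -
  have "continuous_on UNIV (\<lambda>t::real. - 2 * max 0 (1 - t))" by (intro continuous_intros)
  from C1_map_compose_real[OF C1_map_inner_self DERIV_bump_profile this]
  show ?thesis by (simp add: bump_def[abs_def])
qed

lemma bump_eq_0: "norm x \<ge> 1 \<Longrightarrow> bump x = 0"
  by (simp add: bump_def dot_square_norm one_le_power)

lemma bump_bounds: "0 \<le> bump x" "bump x \<le> 1"
proof -
  show "0 \<le> bump x" by (simp add: bump_def)
  show "bump x \<le> 1" unfolding bump_def by (intro power_le_one) auto
qed

lemma partial_deriv_bump_bound: "\<bar>partial_deriv i bump (x :: real^'d::finite)\<bar> \<le> 4"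
proof -
  have eq: "partial_deriv i bump x = - 2 * max 0 (1 - x \<bullet> x) * (2 * x $ i)"
    unfolding bump_def[abs_def]
      partial_deriv_compose_real[OF C1_map_inner_self DERIV_bump_profile]
      partial_deriv_eq[OF has_derivative_inner_self] by (simp add: inner_axis)
  show ?thesis
  proof (cases "norm x \<le> 1")
    case True
    then have "max 0 (1 - x \<bullet> x) * \<bar>x $ i\<bar> \<le> 1 * 1"
      using component_le_norm_cart[of x i] by (intro mult_mono) auto
    then show ?thesis unfolding eq by (simp add: abs_mult)
  next
    case False
    then have "x \<bullet> x \<ge> 1" by (simp add: dot_square_norm one_le_power)
    then show ?thesis unfolding eq by simp
  qed
qed

lemma partial_deriv_scale:
  assumes "C1_map f"
  shows "partial_deriv i (\<lambda>x. f (c *\<^sub>R x)) x = c * partial_deriv i f (c *\<^sub>R x)"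
proof -
  obtain f' where f: "\<And>x. (f has_derivative f' x) (at x)" using assms by (rule C1_mapE) blast
  have "((\<lambda>x. f (c *\<^sub>R x)) has_derivative (\<lambda>v. f' (c *\<^sub>R x) (c *\<^sub>R v))) (at x)"
    by (rule has_derivative_compose[OF _ f]) (auto intro!: derivative_eq_intros)
  then show ?thesis
    using linear_cmul[OF has_derivative_linear[OF f]]
    by (simp add: partial_deriv_eq[OF f] partial_deriv_eq)
qed

lemma exists_mollifier:
  assumes "\<epsilon> > 0"
  obtains \<rho> :: "'a::euclidean_space \<Rightarrow> real" where "C1_map \<rho>" "\<And>x. 0 \<le> \<rho> x" "\<And>x. norm x > \<epsilon> \<Longrightarrow> \<rho> x = 0"
    "integrable lborel \<rho>" "(LINT x|lborel. \<rho> x) = 1"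
proof -
  define k :: "'a \<Rightarrow> real" where "k x = bump (inverse \<epsilon> *\<^sub>R x)" for x
  have k: "C1_map k" unfolding k_def using C1_map_affine[OF C1_map_bump, of "inverse \<epsilon>" 0] by simp
  have k0: "k x = 0" if "x \<notin> cball 0 \<epsilon>" for x
    using that assms by (auto simp: k_def field_simps intro!: bump_eq_0)
  have pos: "0 \<le> k x" for x by (simp add: k_def bump_bounds)
  have int: "integrable lborel k"
    using C1_map_continuous_on[OF k] compact_cball k0 by (rule integrable_continuous_compact_support)
  have "(LINT x|lborel. k x) \<noteq> 0"
  proof
    assume "(LINT x|lborel. k x) = 0"
    then have "AE x in lborel. k x = 0"
      using integral_nonneg_eq_0_iff_AE[OF int] pos by simp
    then have "AE x in lborel. x \<notin> ball (0::'a) \<epsilon>"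
    proof (rule eventually_mono)
      fix x assume k_x: "k x = 0"
      have "k x > 0" if "norm x < \<epsilon>"
      proof -
        have "norm (inverse \<epsilon> *\<^sub>R x) < 1" using that assms by (simp add: field_simps)
        then have "(inverse \<epsilon> *\<^sub>R x) \<bullet> (inverse \<epsilon> *\<^sub>R x) < 1"
          unfolding dot_square_norm by (simp only: power_less_one_iff abs_square_less_1 abs_norm_cancel)
        then show ?thesis unfolding k_def bump_def by (intro zero_less_power) simp
      qed
      then show "x \<notin> ball 0 \<epsilon>" using k_x by auto
    qed
    then have "emeasure lborel (ball (0::'a) \<epsilon>) = 0"
      by (subst (asm) AE_iff_measurable[OF _ refl]) (auto simp: ball_def)
    moreover have "ball (0::'a) \<epsilon> \<noteq> {}" using assms by simp
    ultimately show False
      using open_not_negligible[of "ball (0::'a) \<epsilon>"]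
      by (simp add: negligible_iff_emeasure0)
  qed
  moreover have "(LINT x|lborel. k x) \<ge> 0" using pos by simp
  ultimately have I: "(LINT x|lborel. k x) > 0" by simp
  show thesis
  proof (rule that[of "\<lambda>x. inverse (LINT x|lborel. k x) * k x"])
    show "C1_map (\<lambda>x. inverse (LINT x|lborel. k x) * k x)"
      by (intro C1_map_mult C1_map_const k)
    show "inverse (LINT x|lborel. k x) * k x = 0" if "norm x > \<epsilon>" for x
      using k0[of x] that by simp
  qed (use I pos int in auto)
qed

text \<open>The cut-off is moved onto the test field, where it preserves admissibility; only its gradient
  produces an error. The factor \<open>2\<close> bounds the sum of two components of a test field.\<close>

lemma hermite_variation_cutoff:
  fixes f :: "real^'d::finite \<Rightarrow> real"
  assumes f: "integrable lborel f" and \<alpha>: "\<alpha> > 0" and \<xi>: "C1_map \<xi>" "\<And>x. 0 \<le> \<xi> x" "\<And>x. \<xi> x \<le> 1"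
    and L: "\<And>i x. \<bar>partial_deriv i \<xi> x\<bar> \<le> L"
  shows "hermite_variation \<alpha> (\<lambda>x. \<xi> x * f x)
    \<le> hermite_variation \<alpha> f + ereal (2 * L * CARD('d) * (LINT x|lborel. \<bar>f x\<bar>))"
proof (rule hermite_variation_leI)
  have \<xi>m[measurable]: "\<xi> \<in> borel_measurable borel"
    by (rule borel_measurable_continuous_onI[OF C1_map_continuous_on[OF \<xi>(1)]])
  have fm[measurable]: "f \<in> borel_measurable borel" using f by auto
  show "(\<lambda>x. \<xi> x * f x) \<in> borel_measurable borel" by measurable
  fix \<phi> :: "real^'d \<Rightarrow> real^('d + 'd)" assume \<phi>: "\<phi> \<in> test_fields"
  obtain K where K: "C1_map \<phi>" "compact K" "\<And>x. x \<notin> K \<Longrightarrow> \<phi> x = 0" "\<And>x. norm (\<phi> x) \<le> 1"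
    using \<phi> by (rule test_fieldsE) blast
  define \<eta> where "\<eta> x = \<xi> x *\<^sub>R \<phi> x" for x
  have \<eta>: "\<eta> \<in> test_fields"
  proof (rule test_fieldsI[OF _ K(2)])
    show "C1_map \<eta>" unfolding \<eta>_def using \<xi>(1) K(1) by (rule C1_map_scaleR)
    show "norm (\<eta> x) \<le> 1" for x
      using mult_mono[OF \<xi>(3) K(4)] \<xi>(2) by (simp add: \<eta>_def)
  qed (simp add: \<eta>_def K(3))
  have "(LINT x|lborel. \<xi> x * f x * hermite_div \<alpha> \<phi> x)
      \<le> (LINT x|lborel. f x * hermite_div \<alpha> \<eta> x + (2 * L * CARD('d)) * \<bar>f x\<bar>)"
  proof (rule integral_mono)
    show "integrable lborel (\<lambda>x. \<xi> x * f x * hermite_div \<alpha> \<phi> x)"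
    proof -
      have "integrable lborel (\<lambda>x. (f x * hermite_div \<alpha> \<phi> x) * \<xi> x)"
        by (rule integrable_mult_bounded[OF integrable_mult_hermite_div[OF f \<phi> \<alpha>], of _ 1]) (simp_all add: \<xi>)
      then show ?thesis by (simp add: mult_ac)
    qed
    show "integrable lborel (\<lambda>x. f x * hermite_div \<alpha> \<eta> x + (2 * L * CARD('d)) * \<bar>f x\<bar>)"
      using f by (intro Bochner_Integration.integrable_add integrable_mult_hermite_div \<eta> \<alpha>) auto
    fix x
    define e where "e = (\<Sum>i\<in>UNIV. partial_deriv i \<xi> x * (\<phi> x $ Inl i + \<phi> x $ Inr i))"
    have "\<bar>e\<bar> \<le> (\<Sum>i\<in>(UNIV::'d set). L * 2)"
    unfolding e_def
    proof (rule order_trans[OF sum_abs sum_mono])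
      fix i :: 'd
      have "\<bar>\<phi> x $ Inl i + \<phi> x $ Inr i\<bar> \<le> 2"
        using test_field_component_bound[OF \<phi>, of x "Inl i"] test_field_component_bound[OF \<phi>, of x "Inr i"] by linarith
      then show "\<bar>partial_deriv i \<xi> x * (\<phi> x $ Inl i + \<phi> x $ Inr i)\<bar> \<le> L * 2"
        unfolding abs_mult using L[of i x] by (intro mult_mono) auto
    qed
    then have "\<bar>f x\<bar> * \<bar>e\<bar> \<le> \<bar>f x\<bar> * (2 * L * CARD('d))"
      by (intro mult_left_mono) (auto simp: mult_ac)
    moreover have D: "hermite_div \<alpha> \<eta> x = \<xi> x * hermite_div \<alpha> \<phi> x + e"
      unfolding \<eta>_def e_def using \<xi>(1) K(1) by (rule hermite_div_scaleR)
    ultimately have "- (f x * e) \<le> \<bar>f x\<bar> * (2 * L * CARD('d))"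
      using abs_ge_minus_self[of "f x * e"] by (simp add: abs_mult)
    then show "\<xi> x * f x * hermite_div \<alpha> \<phi> x \<le> f x * hermite_div \<alpha> \<eta> x + (2 * L * CARD('d)) * \<bar>f x\<bar>"
      unfolding D by (simp add: algebra_simps)
  qed
  also have "\<dots> = (LINT x|lborel. f x * hermite_div \<alpha> \<eta> x) + 2 * L * CARD('d) * (LINT x|lborel. \<bar>f x\<bar>)"
    using f by (simp add: integrable_mult_hermite_div[OF f \<eta> \<alpha>])
  finally have "ereal (LINT x|lborel. \<xi> x * f x * hermite_div \<alpha> \<phi> x)
      \<le> ereal (LINT x|lborel. f x * hermite_div \<alpha> \<eta> x) + ereal (2 * L * CARD('d) * (LINT x|lborel. \<bar>f x\<bar>))"
    by simp
  also have "\<dots> \<le> hermite_variation \<alpha> f + ereal (2 * L * CARD('d) * (LINT x|lborel. \<bar>f x\<bar>))"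
    by (intro add_right_mono integral_le_hermite_variation fm \<eta> \<alpha>)
  finally show "ereal (LINT x|lborel. \<xi> x * f x * hermite_div \<alpha> \<phi> x)
      \<le> hermite_variation \<alpha> f + ereal (2 * L * CARD('d) * (LINT x|lborel. \<bar>f x\<bar>))" .
qed (rule \<alpha>)

text \<open>The translation is moved onto the test field. The error comes from the increments of the potential,
  and only at points where \<open>f\<close> does not vanish, so for \<open>f\<close> with bounded support it is small even
  though the potential may be unbounded.\<close>

lemma hermite_variation_shift:
  fixes f :: "real^'d::finite \<Rightarrow> real"
  assumes f: "integrable lborel f" and \<alpha>: "\<alpha> > 0"
    and \<omega>: "\<And>i x. f x \<noteq> 0 \<Longrightarrow> \<bar>hermite_potential \<alpha> i x - hermite_potential \<alpha> i (x - y)\<bar> \<le> \<omega>"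
  shows "hermite_variation \<alpha> (\<lambda>x. f (x + y))
    \<le> hermite_variation \<alpha> f + ereal (2 * \<omega> * CARD('d) * (LINT x|lborel. \<bar>f x\<bar>))"
proof (rule hermite_variation_leI)
  have fm[measurable]: "f \<in> borel_measurable borel" using f by auto
  show "(\<lambda>x. f (x + y)) \<in> borel_measurable borel" by measurable
  fix \<phi> :: "real^'d \<Rightarrow> real^('d + 'd)" assume \<phi>: "\<phi> \<in> test_fields"
  obtain K where K: "C1_map \<phi>" "compact K" "\<And>x. x \<notin> K \<Longrightarrow> \<phi> x = 0" "\<And>x. norm (\<phi> x) \<le> 1"
    using \<phi> by (rule test_fieldsE) blast
  note Dm[measurable] = hermite_div_test_field(1)[OF \<phi> \<alpha>]
  define \<eta> where "\<eta> x = \<phi> (x + - y)" for x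
  have \<eta>: "\<eta> \<in> test_fields"
  proof (rule test_fieldsI)
    show "C1_map \<eta>" unfolding \<eta>_def using C1_map_affine[OF K(1), of 1 "- y"] by simp
    show "compact ((+) y ` K)" using K(2) by (rule compact_translation)
    show "\<eta> x = 0" if "x \<notin> (+) y ` K" for x
    proof -
      have "x - y \<notin> K" using that image_eqI[of x "(+) y" "x - y" K] by auto
      then show ?thesis by (simp add: \<eta>_def K(3))
    qed
  qed (simp add: \<eta>_def K(4))
  have "(LINT x|lborel. f (x + y) * hermite_div \<alpha> \<phi> x)
      = (LINT x|lborel. f x * hermite_div \<alpha> \<phi> (x - y))"
    using lborel_integral_shift[of "\<lambda>x. f x * hermite_div \<alpha> \<phi> (x - y)" y] by simp
  also have "\<dots> \<le> (LINT x|lborel. f x * hermite_div \<alpha> \<eta> x + (2 * \<omega> * CARD('d)) * \<bar>f x\<bar>)"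
  proof (rule integral_mono)
    show "integrable lborel (\<lambda>x. f x * hermite_div \<alpha> \<phi> (x - y))"
    proof -
      obtain M where "\<forall>x. \<bar>hermite_div \<alpha> \<phi> x\<bar> \<le> M" using hermite_div_test_field(3)[OF \<phi> \<alpha>] by blast
      then show ?thesis by (intro integrable_mult_bounded[OF f, of _ M]) auto
    qed
    show "integrable lborel (\<lambda>x. f x * hermite_div \<alpha> \<eta> x + (2 * \<omega> * CARD('d)) * \<bar>f x\<bar>)"
      using f by (intro Bochner_Integration.integrable_add integrable_mult_hermite_div \<eta> \<alpha>) auto
    fix x
    define e where "e = (\<Sum>i\<in>UNIV. (hermite_potential \<alpha> i x - hermite_potential \<alpha> i (x + - y)) *
       (\<phi> (x + - y) $ Inl i - \<phi> (x + - y) $ Inr i))"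
    have "\<bar>f x\<bar> * \<bar>e\<bar> \<le> \<bar>f x\<bar> * (2 * \<omega> * CARD('d))"
    proof (cases "f x = 0")
      case False
      have "\<bar>e\<bar> \<le> (\<Sum>i\<in>(UNIV::'d set). \<omega> * 2)"
      unfolding e_def
      proof (rule order_trans[OF sum_abs sum_mono])
        fix i :: 'd
        have "\<bar>\<phi> (x + - y) $ Inl i - \<phi> (x + - y) $ Inr i\<bar> \<le> 2"
          using test_field_component_bound[OF \<phi>, of "x + - y" "Inl i"]
            test_field_component_bound[OF \<phi>, of "x + - y" "Inr i"] by linarith
        then show "\<bar>(hermite_potential \<alpha> i x - hermite_potential \<alpha> i (x + - y)) *
            (\<phi> (x + - y) $ Inl i - \<phi> (x + - y) $ Inr i)\<bar> \<le> \<omega> * 2"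
          unfolding abs_mult using \<omega>[OF False, of i] by (intro mult_mono) auto
      qed
      then show ?thesis by (intro mult_left_mono) (auto simp: mult_ac)
    qed simp
    moreover have D: "hermite_div \<alpha> \<eta> x = hermite_div \<alpha> \<phi> (x - y) + e"
      unfolding \<eta>_def e_def hermite_div_shift by (simp only: add_uminus_conv_diff)
    ultimately have "- (f x * e) \<le> \<bar>f x\<bar> * (2 * \<omega> * CARD('d))"
      using abs_ge_minus_self[of "f x * e"] by (simp add: abs_mult)
    then show "f x * hermite_div \<alpha> \<phi> (x - y) \<le> f x * hermite_div \<alpha> \<eta> x + (2 * \<omega> * CARD('d)) * \<bar>f x\<bar>"
      unfolding D by (simp add: algebra_simps)
  qed
  also have "\<dots> = (LINT x|lborel. f x * hermite_div \<alpha> \<eta> x) + 2 * \<omega> * CARD('d) * (LINT x|lborel. \<bar>f x\<bar>)"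
    using f by (simp add: integrable_mult_hermite_div[OF f \<eta> \<alpha>])
  finally have "ereal (LINT x|lborel. f (x + y) * hermite_div \<alpha> \<phi> x)
      \<le> ereal (LINT x|lborel. f x * hermite_div \<alpha> \<eta> x) + ereal (2 * \<omega> * CARD('d) * (LINT x|lborel. \<bar>f x\<bar>))"
    by simp
  also have "\<dots> \<le> hermite_variation \<alpha> f + ereal (2 * \<omega> * CARD('d) * (LINT x|lborel. \<bar>f x\<bar>))"
    by (intro add_right_mono integral_le_hermite_variation fm \<eta> \<alpha>)
  finally show "ereal (LINT x|lborel. f (x + y) * hermite_div \<alpha> \<phi> x)
      \<le> hermite_variation \<alpha> f + ereal (2 * \<omega> * CARD('d) * (LINT x|lborel. \<bar>f x\<bar>))" .
qed (rule \<alpha>)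

section \<open>Approximation by continuously differentiable functions\<close>

lemma lborel_integrable_shift:
  fixes f :: "'a::euclidean_space \<Rightarrow> real"
  assumes "integrable lborel f"
  shows "integrable lborel (\<lambda>x. f (x + y))"
proof -
  have "integrable (distr lborel borel ((+) y)) f"
    using assms by (simp add: lborel_distr_plus)
  then have "integrable lborel (\<lambda>x. f (y + x))"
    by (rule integrable_distr[rotated]) simp
  then show ?thesis by (simp add: add.commute)
qed

lemma integrable_indicator_cball: "integrable lborel (indicator (cball (0::'a::euclidean_space) R) :: 'a \<Rightarrow> real)"
  by (intro integrable_real_indicator emeasure_bounded_finite) auto

lemma integrable_bounded_support:
  fixes f :: "'a::euclidean_space \<Rightarrow> real"
  assumes "f \<in> borel_measurable borel" "\<And>x. \<bar>f x\<bar> \<le> M" "\<And>x. norm x > R \<Longrightarrow> f x = 0"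
  shows "integrable lborel f"
proof -
  have "integrable lborel (\<lambda>x. indicator (cball 0 R) x * f x)"
    using assms(1,2) by (intro integrable_mult_bounded[OF integrable_indicator_cball]) auto
  moreover have "(\<lambda>x. indicator (cball 0 R) x * f x) = f"
    using assms(3) by (force simp: indicator_def)
  ultimately show ?thesis by simp
qed

text \<open>A measurable function is an almost everywhere limit of continuous functions. Clamping these to
  \<open>[-M, M]\<close> and cutting them off outside the support turns this into dominated convergence.\<close>

lemma exists_continuous_L1_approx:
  fixes f :: "'a::euclidean_space \<Rightarrow> real"
  assumes fm: "f \<in> borel_measurable borel" and bound: "\<And>x. \<bar>f x\<bar> \<le> M"
    and supp: "\<And>x. norm x > R \<Longrightarrow> f x = 0" and "e > 0"
  obtains g where "continuous_on UNIV g" "\<And>x. norm x > R + 1 \<Longrightarrow> g x = 0"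
    "(LINT x|lborel. \<bar>f x - g x\<bar>) < e"
proof -
  have "f \<in> borel_measurable lebesgue" using fm by (intro measurable_completion) simp
  then have "f measurable_on UNIV" by (rule lebesgue_measurable_imp_measurable_on) simp
  then obtain N G where N: "negligible N" and G: "\<And>n. continuous_on UNIV (G n)"
    and lim: "\<And>x. x \<notin> N \<Longrightarrow> (\<lambda>n. G n x) \<longlonglongrightarrow> f x"
    unfolding measurable_on_def by auto
  have M0: "0 \<le> M" using bound[of 0] by linarith
  define \<zeta> :: "'a \<Rightarrow> real" where "\<zeta> x = max 0 (min 1 (R + 1 - norm x))" for x
  have \<zeta>: "continuous_on UNIV \<zeta>" "0 \<le> \<zeta> x" "\<zeta> x \<le> 1" for x
    unfolding \<zeta>_def by (auto intro!: continuous_intros)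
  define g where "g n x = max (- M) (min M (G n x)) * \<zeta> x" for n x
  have g: "continuous_on UNIV (g n)" for n
    unfolding g_def by (intro continuous_intros G \<zeta>)
  have g0: "g n x = 0" if "norm x > R + 1" for n x
    using that by (simp add: g_def \<zeta>_def)
  have gM: "\<bar>g n x\<bar> \<le> M" for n x
  proof -
    have "\<bar>g n x\<bar> = \<bar>max (- M) (min M (G n x))\<bar> * \<zeta> x" using \<zeta>(2) by (simp add: g_def abs_mult)
    also have "\<dots> \<le> M * 1" using M0 \<zeta>(2,3) by (intro mult_mono) auto
    finally show ?thesis by simp
  qed
  have [measurable]: "f \<in> borel_measurable borel" "g n \<in> borel_measurable borel" for n
    using fm g by (auto intro: borel_measurable_continuous_onI)
  have "(\<lambda>n. LINT x|lborel. \<bar>f x - g n x\<bar>) \<longlonglongrightarrow> (LINT x|(lborel :: 'a measure). (0 :: real))"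
  proof (rule integral_dominated_convergence[where w = "\<lambda>x::'a. indicator (cball 0 (R + 1)) x * (2 * M)"])
    show "integrable lborel (\<lambda>x::'a. indicator (cball 0 (R + 1)) x * (2 * M))"
      using integrable_indicator_cball by (rule integrable_mult_left)
    have "AE x in lebesgue. x \<notin> N" using N by (simp add: negligible_iff_null_sets AE_not_in)
    then have "AE x in lebesgue. (\<lambda>n. \<bar>f x - g n x\<bar>) \<longlonglongrightarrow> 0"
    proof (rule eventually_mono)
      fix x assume "x \<notin> N"
      then have "(\<lambda>n. g n x) \<longlonglongrightarrow> max (- M) (min M (f x)) * \<zeta> x"
        unfolding g_def by (intro tendsto_intros lim)
      moreover have "max (- M) (min M (f x)) = f x" using bound[of x] by (auto simp: abs_le_iff)
      moreover have "f x * \<zeta> x = f x"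
        using supp[of x] by (cases "norm x > R") (auto simp: \<zeta>_def)
      ultimately have "(\<lambda>n. g n x) \<longlonglongrightarrow> f x" by simp
      then have "(\<lambda>n. f x - g n x) \<longlonglongrightarrow> f x - f x" by (intro tendsto_intros)
      then show "(\<lambda>n. \<bar>f x - g n x\<bar>) \<longlonglongrightarrow> 0" by (simp add: tendsto_rabs_zero)
    qed
    then show "AE x in lborel. (\<lambda>n. \<bar>f x - g n x\<bar>) \<longlonglongrightarrow> 0" by (simp add: AE_completion_iff)
    show "AE x in lborel. norm \<bar>f x - g n x\<bar> \<le> indicator (cball 0 (R + 1)) x * (2 * M)" for n
    proof (rule AE_I2)
      fix x
      show "norm \<bar>f x - g n x\<bar> \<le> indicator (cball 0 (R + 1)) x * (2 * M)"
        using gM[of n x] bound[of x] supp[of x] g0[of x n]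
        by (cases "norm x \<le> R + 1") (auto simp: abs_le_iff)
    qed
  qed auto
  then have "\<forall>\<^sub>F n in sequentially. (LINT x|lborel. \<bar>f x - g n x\<bar>) < e"
    using \<open>e > 0\<close> by (intro order_tendstoD) auto
  then obtain n where "(LINT x|lborel. \<bar>f x - g n x\<bar>) < e"
    by (auto simp: eventually_sequentially)
  then show thesis using that g g0 by blast
qed

lemma L1_continuity_of_translation:
  fixes f :: "'a::euclidean_space \<Rightarrow> real"
  assumes fm: "f \<in> borel_measurable borel" and bound: "\<And>x. \<bar>f x\<bar> \<le> M"
    and supp: "\<And>x. norm x > R \<Longrightarrow> f x = 0" and "e > 0"
  obtains d where "d > 0" "\<And>y. norm y \<le> d \<Longrightarrow> (LINT x|lborel. \<bar>f (x + y) - f x\<bar>) \<le> e"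
proof -
  have "e / 3 > 0" using \<open>e > 0\<close> by simp
  then obtain g where g: "continuous_on UNIV g" "\<And>x. norm x > R + 1 \<Longrightarrow> g x = 0"
    and fg: "(LINT x|lborel. \<bar>f x - g x\<bar>) < e / 3"
    using exists_continuous_L1_approx[OF fm bound supp] by metis
  have g0: "g x = 0" if "x \<notin> cball 0 (R + 1)" for x using g(2) that by simp
  define V where "V = (LINT x|lborel. indicator (cball (0::'a) (R + 2)) x :: real)"
  have V: "V \<ge> 0" unfolding V_def by simp
  then have "e / (3 * (V + 1)) > 0" using \<open>e > 0\<close> by simp
  then obtain d where d: "d > 0" "\<And>x y. norm (x - y) \<le> d \<Longrightarrow> norm (g x - g y) < e / (3 * (V + 1))"
    using uniformly_continuous_compact_support[OF g(1) compact_cball g0] by metis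
  have int_f: "integrable lborel f" using fm bound supp by (rule integrable_bounded_support)
  have int_g: "integrable lborel g" using g(1) compact_cball g0 by (rule integrable_continuous_compact_support)
  have "(LINT x|lborel. \<bar>f (x + y) - f x\<bar>) \<le> e" if y: "norm y \<le> min d 1" for y
  proof -
    have int1: "integrable lborel (\<lambda>x. \<bar>f (x + y) - g (x + y)\<bar>)" and int2: "integrable lborel (\<lambda>x. \<bar>f x - g x\<bar>)"
      using int_f int_g lborel_integrable_shift[of "\<lambda>x. \<bar>f x - g x\<bar>" y] by auto
    define J :: "'a \<Rightarrow> real" where "J x = indicator (cball 0 (R + 2)) x * (e / (3 * (V + 1)))" for x
    have int3: "integrable lborel J"
      unfolding J_def by (rule integrable_mult_left[OF integrable_indicator_cball])
    have J: "(LINT x|lborel. J x) = V * (e / (3 * (V + 1)))"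
      unfolding J_def by (subst integral_mult_left_zero) (simp only: V_def)
    have "(LINT x|lborel. \<bar>f (x + y) - f x\<bar>)
        \<le> (LINT x|lborel. \<bar>f (x + y) - g (x + y)\<bar> + \<bar>f x - g x\<bar> + J x)"
    proof (rule integral_mono)
      show "\<bar>f (x + y) - f x\<bar> \<le> \<bar>f (x + y) - g (x + y)\<bar> + \<bar>f x - g x\<bar> + J x" for x
      proof (cases "norm x \<le> R + 2")
        case True
        have "\<bar>g (x + y) - g x\<bar> < e / (3 * (V + 1))" using d(2)[of "x + y" x] y by simp
        then show ?thesis using True by (simp add: J_def)
      next
        case False
        then have "norm (x + y) > R + 1" using y norm_triangle_ineq4[of "x + y" y] by simp
        then show ?thesis using False g(2)[of x] g(2)[of "x + y"] by (simp add: J_def)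
      qed
      show "integrable lborel (\<lambda>x. \<bar>f (x + y) - f x\<bar>)"
        using int_f lborel_integrable_shift by (intro integrable_abs Bochner_Integration.integrable_diff)
    qed (intro Bochner_Integration.integrable_add int1 int2 int3)
    also have "\<dots> = (LINT x|lborel. \<bar>f (x + y) - g (x + y)\<bar>) + (LINT x|lborel. \<bar>f x - g x\<bar>) + V * (e / (3 * (V + 1)))"
      by (simp only: J Bochner_Integration.integral_add int1 int2 int3
          Bochner_Integration.integrable_add)
    also have "(LINT x|lborel. \<bar>f (x + y) - g (x + y)\<bar>) = (LINT x|lborel. \<bar>f x - g x\<bar>)"
      using fm borel_measurable_continuous_onI[OF g(1)]
      by (intro lborel_integral_shift[of "\<lambda>x. \<bar>f x - g x\<bar>"]) measurable
    also have "V * (e / (3 * (V + 1))) = (V / (V + 1)) * (e / 3)"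
      using V by (simp add: field_simps)
    also have "\<dots> \<le> 1 * (e / 3)" using V \<open>e > 0\<close> by (intro mult_right_mono) auto
    finally show ?thesis using fg by simp
  qed
  then show thesis using that[of "min d 1"] d(1) by simp
qed

text \<open>A mollification is a weighted average of translates, so that a bound on a linear functional
  valid for all small translates passes to it.\<close>

lemma integral_mollified_le:
  fixes f w \<rho> :: "'a::euclidean_space \<Rightarrow> real"
  assumes fm: "f \<in> borel_measurable borel" "\<And>x. \<bar>f x\<bar> \<le> M" "\<And>x. norm x > R \<Longrightarrow> f x = 0"
    and w: "w \<in> borel_measurable borel" "\<And>x. \<bar>w x\<bar> \<le> B"
    and \<rho>: "\<And>x. 0 \<le> \<rho> x" "\<And>x. norm x > \<epsilon> \<Longrightarrow> \<rho> x = 0" "integrable lborel \<rho>" "(LINT x|lborel. \<rho> x) = 1"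
    and c: "\<And>y. norm y \<le> \<epsilon> \<Longrightarrow> (LINT x|lborel. f (x + y) * w x) \<le> c"
  shows "(LINT x|lborel. (LINT z|lborel. f z * \<rho> (z - x)) * w x) \<le> c"
proof -
  have [measurable]: "f \<in> borel_measurable borel" "w \<in> borel_measurable borel" "\<rho> \<in> borel_measurable borel"
    using fm(1) w(1) \<rho>(3) by auto
  have M0: "0 \<le> M" "0 \<le> B" using fm(2)[of 0] w(2)[of 0] by linarith+
  have [measurable]: "cball (0::'a) (R + \<epsilon>) \<in> sets borel" by simp
  define F where "F x y = \<rho> y * (f (x + y) * w x)" for x y
  have int: "integrable (lborel \<Otimes>\<^sub>M lborel) (\<lambda>(x, y). F x y)"
  proof (rule Bochner_Integration.integrable_bound)
    show "integrable (lborel \<Otimes>\<^sub>M lborel) (\<lambda>(x, y). indicator (cball (0::'a) (R + \<epsilon>)) x * (M * B) * \<rho> y)"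
    proof (rule lborel_pair.Fubini_integrable)
      show "(\<lambda>(x, y). indicator (cball (0::'a) (R + \<epsilon>)) x * (M * B) * \<rho> y) \<in> borel_measurable (lborel \<Otimes>\<^sub>M lborel)"
        by measurable
      show "AE x in lborel. integrable lborel (\<lambda>y. case (x, y) of (x, y) \<Rightarrow> indicator (cball (0::'a) (R + \<epsilon>)) x * (M * B) * \<rho> y)"
        using \<rho>(3) by simp
      have "(\<lambda>x. LINT y|lborel. norm (case (x, y) of (x, y) \<Rightarrow> indicator (cball (0::'a) (R + \<epsilon>)) x * (M * B) * \<rho> y))
          = (\<lambda>x. indicator (cball (0::'a) (R + \<epsilon>)) x * (M * B))"
        using \<rho>(1,3,4) M0 by (simp add: abs_mult)
      then show "integrable lborel (\<lambda>x. LINT y|lborel. norm (case (x, y) of (x, y) \<Rightarrow> indicator (cball (0::'a) (R + \<epsilon>)) x * (M * B) * \<rho> y))"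
        using integrable_indicator_cball[where 'a = 'a] by simp
    qed
    show "(\<lambda>(x, y). F x y) \<in> borel_measurable (lborel \<Otimes>\<^sub>M lborel)"
      unfolding F_def by measurable
    have "\<bar>F x y\<bar> \<le> indicator (cball (0::'a) (R + \<epsilon>)) x * (M * B) * \<rho> y" for x y
    proof (cases "norm x \<le> R + \<epsilon> \<and> norm y \<le> \<epsilon>")
      case True
      have "\<bar>f (x + y)\<bar> * \<bar>w x\<bar> \<le> M * B" using fm(2) w(2) M0 by (intro mult_mono) auto
      then show ?thesis using True \<rho>(1)[of y] by (simp add: F_def abs_mult mult.commute mult_left_mono)
    next
      case False
      then have "F x y = 0"
      proof (cases "norm y \<le> \<epsilon>")
        case True
        then have "norm (x + y) > R" using False norm_triangle_ineq4[of "x + y" y] by simp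
        then show ?thesis by (simp add: F_def fm(3))
      qed (simp add: F_def \<rho>(2))
      then show ?thesis using \<rho>(1) M0 by simp
    qed
    then show "AE p in lborel \<Otimes>\<^sub>M lborel. norm (case p of (x, y) \<Rightarrow> F x y)
        \<le> norm (case p of (x, y) \<Rightarrow> indicator (cball (0::'a) (R + \<epsilon>)) x * (M * B) * \<rho> y)"
      by (intro AE_I2) (auto intro: order_trans[OF _ abs_ge_self])
  qed
  have "(LINT z|lborel. f z * \<rho> (z - x)) * w x = (LINT y|lborel. F x y)" for x
  proof -
    have "(LINT z|lborel. f z * \<rho> (z - x)) = (LINT y|lborel. f (x + y) * \<rho> y)"
      using lborel_integral_shift[of "\<lambda>z. f z * \<rho> (z - x)" x] by (simp add: add.commute)
    moreover have "F x y = f (x + y) * \<rho> y * w x" for y by (simp add: F_def)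
    ultimately show ?thesis by simp
  qed
  then have "(LINT x|lborel. (LINT z|lborel. f z * \<rho> (z - x)) * w x) = (LINT x|lborel. LINT y|lborel. F x y)"
    by simp
  also have "\<dots> = (LINT y|lborel. LINT x|lborel. F x y)"
    using lborel_pair.Fubini_integral[OF int] by simp
  also have "\<dots> \<le> (LINT y|lborel. \<rho> y * c)"
  proof (rule integral_mono)
    show "integrable lborel (\<lambda>y. LINT x|lborel. F x y)"
      using lborel_pair.integrable_snd[OF int] by simp
    show "integrable lborel (\<lambda>y. \<rho> y * c)" using \<rho>(3) by simp
    show "(LINT x|lborel. F x y) \<le> \<rho> y * c" for y
      using c[of y] \<rho>(1,2)[of y] by (cases "norm y \<le> \<epsilon>") (auto simp: F_def intro: mult_left_mono)
  qed
  also have "\<dots> = c" using \<rho>(4) by simp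
  finally show ?thesis .
qed

text \<open>The mollification \<open>g\<close> averages the translates of \<open>f\<close> by vectors of length at most \<open>\<epsilon>\<close>. For such
  translates both the \<open>L\<^sup>1\<close>-distance to \<open>f\<close> and the excess of variation are at most \<open>\<delta>\<close>, and both bounds
  pass to the average because each is a supremum of linear functionals.\<close>

lemma mollify_compact_support:
  fixes f :: "real^'d::finite \<Rightarrow> real"
  assumes \<alpha>: "\<alpha> > 0" and fm: "f \<in> borel_measurable borel" and bound: "\<And>x. \<bar>f x\<bar> \<le> M"
    and supp: "\<And>x. norm x > R \<Longrightarrow> f x = 0" and \<delta>: "\<delta> > 0"
  obtains g where "C1_map g" "integrable lborel g" "(LINT x|lborel. \<bar>g x - f x\<bar>) \<le> \<delta>"
    "hermite_variation \<alpha> g \<le> hermite_variation \<alpha> f + ereal \<delta>"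
proof -
  have int_f: "integrable lborel f" using fm bound supp by (rule integrable_bounded_support)
  define U where "U = (LINT x|lborel. \<bar>f x\<bar>)"
  have U: "U \<ge> 0" by (simp add: U_def)
  define \<omega> where "\<omega> = \<delta> / (2 * CARD('d) * (U + 1))"
  have \<omega>: "\<omega> > 0" "2 * \<omega> * CARD('d) * U \<le> \<delta>"
  proof -
    show "\<omega> > 0" using \<delta> U by (simp add: \<omega>_def)
    have "2 * \<omega> * CARD('d) * U = (U / (U + 1)) * \<delta>" by (simp add: \<omega>_def)
    also have "\<dots> \<le> 1 * \<delta>" using U \<delta> by (intro mult_right_mono) auto
    finally show "2 * \<omega> * CARD('d) * U \<le> \<delta>" by simp
  qed
  obtain d1 where d1: "d1 > 0" "\<And>y. norm y \<le> d1 \<Longrightarrow> (LINT x|lborel. \<bar>f (x + y) - f x\<bar>) \<le> \<delta>"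
    using L1_continuity_of_translation[OF fm bound supp \<delta>] by metis
  have "\<exists>d>0. \<forall>x y. norm x \<le> R + 1 \<longrightarrow> norm y \<le> R + 1 \<longrightarrow> norm (x - y) < d \<longrightarrow>
      \<bar>hermite_potential \<alpha> i x - hermite_potential \<alpha> i y\<bar> \<le> \<omega>" for i :: 'd
  proof -
    have "uniformly_continuous_on (cball 0 (R + 1)) (hermite_potential \<alpha> i)"
      by (intro compact_uniformly_continuous continuous_on_hermite_potential \<alpha> compact_cball)
    then obtain d where "d > 0" "\<forall>x\<in>cball 0 (R + 1). \<forall>y\<in>cball 0 (R + 1). dist y x < d \<longrightarrow>
        dist (hermite_potential \<alpha> i y) (hermite_potential \<alpha> i x) < \<omega>"
      using \<omega>(1) unfolding uniformly_continuous_on_def by meson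
    then show ?thesis
      by (intro exI[of _ d]) (auto simp: dist_norm less_imp_le)
  qed
  then obtain d2 :: "'d \<Rightarrow> real" where d2': "\<forall>i. d2 i > 0 \<and>
      (\<forall>x y. norm x \<le> R + 1 \<longrightarrow> norm y \<le> R + 1 \<longrightarrow> norm (x - y) < d2 i \<longrightarrow>
        \<bar>hermite_potential \<alpha> i x - hermite_potential \<alpha> i y\<bar> \<le> \<omega>)"
    using choice[of "\<lambda>i d. d > 0 \<and> (\<forall>x y. norm x \<le> R + 1 \<longrightarrow> norm y \<le> R + 1 \<longrightarrow> norm (x - y) < d \<longrightarrow>
        \<bar>hermite_potential \<alpha> i x - hermite_potential \<alpha> i y\<bar> \<le> \<omega>)"] by blast
  then have V_close: "\<bar>hermite_potential \<alpha> i x - hermite_potential \<alpha> i y\<bar> \<le> \<omega>"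
    if "norm x \<le> R + 1" "norm y \<le> R + 1" "norm (x - y) < d2 i" for i x y
    using that by blast
  have d2: "d2 i > 0" for i using d2' by blast
  \<comment> \<open>translates by at most \<open>1\<close> stay in the ball of radius \<open>R + 1\<close> on which \<open>d2\<close> controls the potential\<close>
  define \<epsilon> where "\<epsilon> = min (min d1 1) (Min (range d2) / 2)"
  have "Min (range d2) > 0" using d2 by (subst Min_gr_iff) auto
  then have \<epsilon>: "\<epsilon> > 0" using d1 by (simp add: \<epsilon>_def)
  have \<epsilon>_le: "\<epsilon> \<le> d1" "\<epsilon> \<le> 1" "\<epsilon> < d2 i" for i
  proof -
    have "Min (range d2) \<le> d2 i" by simp
    moreover have "\<epsilon> \<le> Min (range d2) / 2" unfolding \<epsilon>_def by (rule min.cobounded2)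
    ultimately show "\<epsilon> < d2 i" using \<open>Min (range d2) > 0\<close> by linarith
  qed (simp_all add: \<epsilon>_def)
  obtain \<rho> :: "real^'d \<Rightarrow> real" where \<rho>: "C1_map \<rho>" "\<And>x. 0 \<le> \<rho> x" "\<And>x. norm x > \<epsilon> \<Longrightarrow> \<rho> x = 0"
    "integrable lborel \<rho>" "(LINT x|lborel. \<rho> x) = 1"
    using exists_mollifier[OF \<epsilon>] by metis
  define g where "g x = (LINT z|lborel. f z * \<rho> (z - x))" for x
  obtain \<rho>' where \<rho>': "\<And>x. (\<rho> has_derivative \<rho>' x) (at x)" "\<And>v. continuous_on UNIV (\<lambda>x. \<rho>' x v)"
    using \<rho>(1) by (rule C1_mapE) blast
  have g: "C1_map g"
    unfolding g_def
    by (rule correlation_C1(2)[OF int_f \<rho>' compact_cball[of 0 \<epsilon>]]) (simp add: \<rho>(3))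
  have g0: "g x = 0" if "x \<notin> cball 0 (R + \<epsilon>)" for x
  proof -
    have eq: "f z * \<rho> (z - x) = 0" for z
    proof (cases "norm z \<le> R")
      case True
      then have "norm (z - x) > \<epsilon>" using that norm_triangle_ineq4[of z "z - x"] by simp
      then show ?thesis by (simp add: \<rho>(3))
    qed (simp add: supp)
    show ?thesis by (simp only: g_def eq) simp
  qed
  have int_g: "integrable lborel g"
    using C1_map_continuous_on[OF g] compact_cball g0 by (rule integrable_continuous_compact_support)
  have gm: "g \<in> borel_measurable borel" using int_g by auto
  have average: "(LINT x|lborel. g x * w x) \<le> c"
    if "w \<in> borel_measurable borel" "\<And>x. \<bar>w x\<bar> \<le> B"
      "\<And>y. norm y \<le> \<epsilon> \<Longrightarrow> (LINT x|lborel. f (x + y) * w x) \<le> c" for w B c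
    unfolding g_def by (rule integral_mollified_le[OF fm bound supp that(1,2) \<rho>(2-5) that(3)])
  have "(LINT x|lborel. \<bar>g x - f x\<bar>) \<le> \<delta>"
  proof -
    \<comment> \<open>the norm is attained by testing with the sign of the difference\<close>
    define w where "w x = sgn (g x - f x)" for x
    have [measurable]: "w \<in> borel_measurable borel" "f \<in> borel_measurable borel"
      unfolding w_def using fm gm by auto
    have w1: "\<bar>w x\<bar> \<le> 1" for x by (simp add: w_def abs_sgn_eq)
    have int_fw: "integrable lborel (\<lambda>x. f (x + y) * w x)" for y
      using w1 by (intro integrable_mult_bounded[OF lborel_integrable_shift[OF int_f]]) auto
    have int_fw0: "integrable lborel (\<lambda>x. f x * w x)" using int_fw[of 0] by simp
    have int_gw: "integrable lborel (\<lambda>x. g x * w x)"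
      using w1 by (intro integrable_mult_bounded[OF int_g]) auto
    have "(LINT x|lborel. g x * w x) \<le> (LINT x|lborel. f x * w x) + \<delta>"
    proof (rule average[where w = w and B = 1])
      fix y :: "real^'d" assume "norm y \<le> \<epsilon>"
      then have "(LINT x|lborel. \<bar>f (x + y) - f x\<bar>) \<le> \<delta>" using d1(2) \<epsilon>_le(1) by simp
      moreover have "(LINT x|lborel. f (x + y) * w x - f x * w x) \<le> (LINT x|lborel. \<bar>f (x + y) - f x\<bar>)"
      proof (rule integral_mono)
        show "f (x + y) * w x - f x * w x \<le> \<bar>f (x + y) - f x\<bar>" for x
        proof -
          have "f (x + y) * w x - f x * w x \<le> \<bar>(f (x + y) - f x) * w x\<bar>"
            unfolding left_diff_distrib[symmetric] by (rule abs_ge_self)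
          also have "\<dots> \<le> \<bar>f (x + y) - f x\<bar> * 1"
            unfolding abs_mult using w1 by (intro mult_left_mono) auto
          finally show ?thesis by simp
        qed
      qed (intro integrable_abs Bochner_Integration.integrable_diff int_fw int_fw0 int_f lborel_integrable_shift)+
      ultimately show "(LINT x|lborel. f (x + y) * w x) \<le> (LINT x|lborel. f x * w x) + \<delta>"
        using int_fw[of y] int_fw0 by simp
    qed (use w1 in auto)
    moreover have "\<bar>g x - f x\<bar> = g x * w x - f x * w x" for x
      by (simp add: w_def abs_sgn left_diff_distrib[symmetric])
    ultimately show ?thesis using int_gw int_fw0 by simp
  qed
  moreover have "hermite_variation \<alpha> g \<le> hermite_variation \<alpha> f + ereal \<delta>"
  proof (rule hermite_variation_leI[OF gm \<alpha>])
    fix \<phi> :: "real^'d \<Rightarrow> real^('d + 'd)" assume \<phi>: "\<phi> \<in> test_fields"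
    obtain B where B: "\<And>x. \<bar>hermite_div \<alpha> \<phi> x\<bar> \<le> B" using hermite_div_test_field(3)[OF \<phi> \<alpha>] by blast
    show "ereal (LINT x|lborel. g x * hermite_div \<alpha> \<phi> x) \<le> hermite_variation \<alpha> f + ereal \<delta>"
    proof (cases "hermite_variation \<alpha> f")
      case (real v)
      have "(LINT x|lborel. g x * hermite_div \<alpha> \<phi> x) \<le> v + \<delta>"
      proof (rule average[OF hermite_div_test_field(1)[OF \<phi> \<alpha>] B])
        fix y :: "real^'d" assume y: "norm y \<le> \<epsilon>"
        have "ereal (LINT x|lborel. f (x + y) * hermite_div \<alpha> \<phi> x) \<le> hermite_variation \<alpha> (\<lambda>x. f (x + y))"
          by (intro integral_le_hermite_variation \<phi> \<alpha> measurable_compose[OF _ fm]) simp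
        also have "\<dots> \<le> hermite_variation \<alpha> f + ereal (2 * \<omega> * CARD('d) * (LINT x|lborel. \<bar>f x\<bar>))"
        proof (rule hermite_variation_shift[OF int_f \<alpha>])
          fix i x assume "f x \<noteq> 0"
          then have x: "norm x \<le> R" using supp by force
          moreover have "norm (x - y) \<le> norm x + norm y" by (rule norm_triangle_ineq4)
          ultimately show "\<bar>hermite_potential \<alpha> i x - hermite_potential \<alpha> i (x - y)\<bar> \<le> \<omega>"
            using y \<epsilon>_le(1,2) \<epsilon>_le(3)[of i] by (intro V_close) auto
        qed
        also have "\<dots> \<le> ereal (v + \<delta>)" using \<omega>(2) real by (simp add: U_def)
        finally show "(LINT x|lborel. f (x + y) * hermite_div \<alpha> \<phi> x) \<le> v + \<delta>" by simp
      qed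
      then show ?thesis using real by simp
    qed (use hermite_variation_nonneg[of \<alpha> f] in auto)
  qed
  ultimately show thesis using that g int_g by blast
qed

text \<open>The cut-off functions \<open>bump (x / (n + 1))\<close> tend to \<open>1\<close> while their gradients are \<open>O(1/n)\<close>, so
  the general case reduces to bounded support.\<close>

lemma hermite_variation_C1_approx:
  fixes f :: "real^'d::finite \<Rightarrow> real"
  assumes \<alpha>: "\<alpha> > 0" and int_f: "integrable lborel f" and bound: "\<And>x. \<bar>f x\<bar> \<le> M" and \<delta>: "\<delta> > 0"
  obtains g where "C1_map g" "integrable lborel g" "(LINT x|lborel. \<bar>g x - f x\<bar>) \<le> \<delta>"
    "hermite_variation \<alpha> g \<le> hermite_variation \<alpha> f + ereal \<delta>"
proof -
  define U where "U = (LINT x|lborel. \<bar>f x\<bar>)"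
  have fm[measurable]: "f \<in> borel_measurable borel" using int_f by auto
  define \<xi> :: "nat \<Rightarrow> real^'d \<Rightarrow> real" where "\<xi> n x = bump (inverse (Suc n) *\<^sub>R x)" for n x
  have \<xi>: "C1_map (\<xi> n)" "0 \<le> \<xi> n x" "\<xi> n x \<le> 1" for n x
    unfolding \<xi>_def using C1_map_affine[OF C1_map_bump, of "inverse (Suc n)" 0] by (simp_all add: bump_bounds)
  have \<xi>m[measurable]: "\<xi> n \<in> borel_measurable borel" for n
    by (rule borel_measurable_continuous_onI[OF C1_map_continuous_on[OF \<xi>(1)]])
  have d\<xi>: "\<bar>partial_deriv i (\<xi> n) x\<bar> \<le> 4 * inverse (Suc n)" for i n x
    unfolding \<xi>_def partial_deriv_scale[OF C1_map_bump] abs_mult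
    using mult_right_mono[OF partial_deriv_bump_bound[of i "inverse (Suc n) *\<^sub>R x"], of "inverse (Suc n)"]
    by (simp add: mult.commute)
  have lim_inv: "(\<lambda>n. inverse (real (Suc n))) \<longlonglongrightarrow> 0" by (rule LIMSEQ_inverse_real_of_nat)
  have "(\<lambda>n. LINT x|lborel. \<bar>\<xi> n x * f x - f x\<bar>) \<longlonglongrightarrow> (LINT x|(lborel :: (real^'d) measure). (0 :: real))"
  proof (rule integral_dominated_convergence[where w = "\<lambda>x. \<bar>f x\<bar>"])
    show "AE x in lborel. (\<lambda>n. \<bar>\<xi> n x * f x - f x\<bar>) \<longlonglongrightarrow> 0"
    proof (rule AE_I2)
      fix x :: "real^'d"
      have "(\<lambda>n. bump (inverse (real (Suc n)) *\<^sub>R x)) \<longlonglongrightarrow> bump (0 *\<^sub>R x)"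
        using C1_map_continuous_on[OF C1_map_bump, of UNIV] continuous_on_eq_continuous_at[OF open_UNIV, of bump]
        by (intro isCont_tendsto_compose[OF _ tendsto_scaleR[OF lim_inv tendsto_const]]) blast
      then have "(\<lambda>n. \<bar>\<xi> n x * f x - f x\<bar>) \<longlonglongrightarrow> \<bar>1 * f x - f x\<bar>"
        unfolding \<xi>_def by (intro tendsto_intros) (simp add: bump_def)
      then show "(\<lambda>n. \<bar>\<xi> n x * f x - f x\<bar>) \<longlonglongrightarrow> 0" by simp
    qed
    show "AE x in lborel. norm \<bar>\<xi> n x * f x - f x\<bar> \<le> \<bar>f x\<bar>" for n
    proof (rule AE_I2)
      fix x
      have "\<bar>\<xi> n x * f x - f x\<bar> = (1 - \<xi> n x) * \<bar>f x\<bar>"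
        using \<xi>(3)[of n x] abs_mult[of "\<xi> n x - 1" "f x"] by (simp add: left_diff_distrib)
      also have "\<dots> \<le> \<bar>f x\<bar>" using \<xi>(2,3)[of n x] by (intro mult_left_le_one_le) auto
      finally show "norm \<bar>\<xi> n x * f x - f x\<bar> \<le> \<bar>f x\<bar>" by simp
    qed
  qed (use int_f in auto)
  then have "\<forall>\<^sub>F n in sequentially. (LINT x|lborel. \<bar>\<xi> n x * f x - f x\<bar>) < \<delta> / 2"
    using \<delta> by (intro order_tendstoD) auto
  moreover have "(\<lambda>n. 2 * (4 * inverse (Suc n)) * CARD('d) * U) \<longlonglongrightarrow> 2 * (4 * 0) * real CARD('d) * U"
    by (intro tendsto_intros lim_inv)
  then have "\<forall>\<^sub>F n in sequentially. 2 * (4 * inverse (Suc n)) * CARD('d) * U < \<delta> / 2"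
    using \<delta> by (intro order_tendstoD) auto
  ultimately have "\<forall>\<^sub>F n in sequentially. (LINT x|lborel. \<bar>\<xi> n x * f x - f x\<bar>) < \<delta> / 2 \<and>
      2 * (4 * inverse (Suc n)) * CARD('d) * U < \<delta> / 2"
    by (rule eventually_conj)
  then obtain n where n: "(LINT x|lborel. \<bar>\<xi> n x * f x - f x\<bar>) < \<delta> / 2"
      "2 * (4 * inverse (Suc n)) * CARD('d) * U < \<delta> / 2"
    by (auto simp: eventually_sequentially)
  define f1 where "f1 x = \<xi> n x * f x" for x
  have f1: "f1 \<in> borel_measurable borel" "\<And>x. \<bar>f1 x\<bar> \<le> M" "\<And>x. norm x > Suc n \<Longrightarrow> f1 x = 0"
  proof -
    show "f1 \<in> borel_measurable borel" unfolding f1_def by measurable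
    show "\<bar>f1 x\<bar> \<le> M" for x
    proof -
      have "\<xi> n x * \<bar>f x\<bar> \<le> 1 * M" using \<xi>(2,3)[of n x] bound[of x] by (intro mult_mono) auto
      then show ?thesis using \<xi>(2)[of n x] by (simp add: f1_def abs_mult)
    qed
    show "f1 x = 0" if "norm x > Suc n" for x
    proof -
      have "norm (inverse (Suc n) *\<^sub>R x) \<ge> 1" using that by (simp add: field_simps)
      then show ?thesis by (simp add: f1_def \<xi>_def bump_eq_0)
    qed
  qed
  have var1: "hermite_variation \<alpha> f1 \<le> hermite_variation \<alpha> f + ereal (\<delta> / 2)"
    unfolding f1_def using hermite_variation_cutoff[OF int_f \<alpha> \<xi> d\<xi>, of n] n(2)[unfolded U_def]
    by (meson add_left_mono ereal_less_eq(3) less_imp_le order_trans)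
  have "\<delta> / 2 > 0" using \<delta> by simp
  from mollify_compact_support[OF \<alpha> f1 this]
  obtain g where g: "C1_map g" "integrable lborel g" "(LINT x|lborel. \<bar>g x - f1 x\<bar>) \<le> \<delta> / 2"
    "hermite_variation \<alpha> g \<le> hermite_variation \<alpha> f1 + ereal (\<delta> / 2)" by metis
  have int_f1: "integrable lborel f1" using f1 by (rule integrable_bounded_support)
  show thesis
  proof (rule that[OF g(1,2)])
    have "(LINT x|lborel. \<bar>g x - f x\<bar>) \<le> (LINT x|lborel. \<bar>g x - f1 x\<bar> + \<bar>f1 x - f x\<bar>)"
      using g(2) int_f int_f1 by (intro integral_mono) auto
    also have "\<dots> = (LINT x|lborel. \<bar>g x - f1 x\<bar>) + (LINT x|lborel. \<bar>f1 x - f x\<bar>)"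
      using g(2) int_f int_f1 by simp
    also have "\<dots> \<le> \<delta>" using g(3) n(1) by (simp add: f1_def)
    finally show "(LINT x|lborel. \<bar>g x - f x\<bar>) \<le> \<delta>" .
    have "hermite_variation \<alpha> g \<le> (hermite_variation \<alpha> f + ereal (\<delta> / 2)) + ereal (\<delta> / 2)"
      using g(4) var1 by (meson add_right_mono order_trans)
    also have "\<dots> = hermite_variation \<alpha> f + ereal \<delta>" by (simp add: add.assoc)
    finally show "hermite_variation \<alpha> g \<le> hermite_variation \<alpha> f + ereal \<delta>" .
  qed
qed

section \<open>Submodularity of the variation\<close>

lemma integral_mult_perturb:
  fixes u v D :: "'a::euclidean_space \<Rightarrow> real"
  assumes "integrable lborel u" "integrable lborel v" "D \<in> borel_measurable borel"
    and "\<And>x. \<bar>D x\<bar> \<le> B" and "(LINT x|lborel. \<bar>u x - v x\<bar>) \<le> \<delta>"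
  shows "(LINT x|lborel. u x * D x) \<le> (LINT x|lborel. v x * D x) + B * \<delta>"
proof -
  have B: "B \<ge> 0" using assms(4)[of 0] by linarith
  have int: "integrable lborel (\<lambda>x. u x * D x)" "integrable lborel (\<lambda>x. v x * D x)"
    using assms by (auto intro!: integrable_mult_bounded)
  have "(LINT x|lborel. u x * D x) - (LINT x|lborel. v x * D x) = (LINT x|lborel. u x * D x - v x * D x)"
    using int by simp
  also have "\<dots> \<le> (LINT x|lborel. B * \<bar>u x - v x\<bar>)"
  proof (rule integral_mono)
    show "integrable lborel (\<lambda>x. u x * D x - v x * D x)" using int by simp
    show "integrable lborel (\<lambda>x. B * \<bar>u x - v x\<bar>)" using assms(1,2) by simp
    show "u x * D x - v x * D x \<le> B * \<bar>u x - v x\<bar>" for x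
    proof -
      have "u x * D x - v x * D x \<le> \<bar>D x * (u x - v x)\<bar>"
        using abs_ge_self[of "D x * (u x - v x)"] by (simp add: algebra_simps)
      also have "\<dots> \<le> B * \<bar>u x - v x\<bar>"
        unfolding abs_mult using assms(4) by (intro mult_right_mono) auto
      finally show ?thesis .
    qed
  qed
  also have "\<dots> \<le> B * \<delta>" using assms(5) B by (simp add: mult_left_mono)
  finally show ?thesis by simp
qed

text \<open>For fixed test fields on the left, both functionals are \<open>L\<^sup>1\<close>-continuous and the maximum and minimum
  depend on \<open>(f, g)\<close> in a Lipschitz way, so the smooth inequality transfers along approximations whose
  variations do not exceed those of \<open>f\<close> and \<open>g\<close> by more than \<open>\<delta>\<close>.\<close>

lemma hermite_variation_submodular_borel:
  fixes f g :: "real^'d::finite \<Rightarrow> real"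
  assumes \<alpha>: "\<alpha> > 0" and f: "integrable lborel f" "\<And>x. \<bar>f x\<bar> \<le> M"
    and g: "integrable lborel g" "\<And>x. \<bar>g x\<bar> \<le> M"
  shows "hermite_variation \<alpha> (\<lambda>x. max (f x) (g x)) + hermite_variation \<alpha> (\<lambda>x. min (f x) (g x))
    \<le> hermite_variation \<alpha> f + hermite_variation \<alpha> g"
proof -
  have fm: "f \<in> borel_measurable borel" and gm: "g \<in> borel_measurable borel" using f(1) g(1) by auto
  note [measurable] = fm gm
  have dual: "ereal ((LINT x|lborel. max (f x) (g x) * hermite_div \<alpha> \<phi> x) +
                (LINT x|lborel. min (f x) (g x) * hermite_div \<alpha> \<psi> x))
         \<le> hermite_variation \<alpha> f + hermite_variation \<alpha> g"
    if \<phi>: "\<phi> \<in> test_fields" and \<psi>: "\<psi> \<in> test_fields" for \<phi> \<psi>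
  proof (rule ereal_le_epsilon2)
    fix e :: real assume "e > 0"
    obtain B1 where B1: "B1 > 0" "\<And>x. \<bar>hermite_div \<alpha> \<phi> x\<bar> \<le> B1"
      using hermite_div_test_field(3)[OF \<phi> \<alpha>] by blast
    obtain B2 where B2: "B2 > 0" "\<And>x. \<bar>hermite_div \<alpha> \<psi> x\<bar> \<le> B2"
      using hermite_div_test_field(3)[OF \<psi> \<alpha>] by blast
    \<comment> \<open>\<open>2 * B1 * \<delta>\<close> and \<open>2 * B2 * \<delta>\<close> pay for replacing \<open>f\<close>, \<open>g\<close> on the left, \<open>2 * \<delta>\<close> for their variations\<close>
    define \<delta> where "\<delta> = e / (2 * B1 + 2 * B2 + 2)"
    have \<delta>: "\<delta> > 0" "B1 * (2 * \<delta>) + B2 * (2 * \<delta>) + 2 * \<delta> = e"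
    proof -
      have pos: "2 * B1 + 2 * B2 + 2 > 0" using B1 B2 by simp
      then show "\<delta> > 0" using \<open>e > 0\<close> by (simp add: \<delta>_def)
      have "(2 * B1 + 2 * B2 + 2) * \<delta> = e" unfolding \<delta>_def using pos by simp
      then show "B1 * (2 * \<delta>) + B2 * (2 * \<delta>) + 2 * \<delta> = e" by (simp add: algebra_simps)
    qed
    obtain f1 where f1: "C1_map f1" "integrable lborel f1" "(LINT x|lborel. \<bar>f1 x - f x\<bar>) \<le> \<delta>"
      "hermite_variation \<alpha> f1 \<le> hermite_variation \<alpha> f + ereal \<delta>"
      using hermite_variation_C1_approx[OF \<alpha> f \<delta>(1)] by metis
    obtain g1 where g1: "C1_map g1" "integrable lborel g1" "(LINT x|lborel. \<bar>g1 x - g x\<bar>) \<le> \<delta>"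
      "hermite_variation \<alpha> g1 \<le> hermite_variation \<alpha> g + ereal \<delta>"
      using hermite_variation_C1_approx[OF \<alpha> g \<delta>(1)] by metis
    have close: "(LINT x|lborel. \<bar>h (f x) (g x) - h (f1 x) (g1 x)\<bar>) \<le> 2 * \<delta>"
      if "integrable lborel (\<lambda>x. h (f x) (g x))" "integrable lborel (\<lambda>x. h (f1 x) (g1 x))"
        "\<And>a b c d. \<bar>h a b - h c d\<bar> \<le> \<bar>c - a\<bar> + \<bar>d - b\<bar>" for h :: "real \<Rightarrow> real \<Rightarrow> real"
    proof -
      have "(LINT x|lborel. \<bar>h (f x) (g x) - h (f1 x) (g1 x)\<bar>)
          \<le> (LINT x|lborel. \<bar>f1 x - f x\<bar> + \<bar>g1 x - g x\<bar>)"
        using that f(1) g(1) f1(2) g1(2) by (intro integral_mono) auto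
      also have "\<dots> \<le> 2 * \<delta>" using f(1) g(1) f1 g1 by simp
      finally show ?thesis .
    qed
    have "(LINT x|lborel. max (f x) (g x) * hermite_div \<alpha> \<phi> x)
        \<le> (LINT x|lborel. max (f1 x) (g1 x) * hermite_div \<alpha> \<phi> x) + B1 * (2 * \<delta>)"
      using f(1) g(1) f1(2) g1(2)
      by (intro integral_mult_perturb close integrable_max hermite_div_test_field(1) \<phi> \<alpha> B1(2)) auto
    moreover have "(LINT x|lborel. min (f x) (g x) * hermite_div \<alpha> \<psi> x)
        \<le> (LINT x|lborel. min (f1 x) (g1 x) * hermite_div \<alpha> \<psi> x) + B2 * (2 * \<delta>)"
      using f(1) g(1) f1(2) g1(2)
      by (intro integral_mult_perturb close integrable_min hermite_div_test_field(1) \<psi> \<alpha> B2(2)) auto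
    ultimately have "ereal ((LINT x|lborel. max (f x) (g x) * hermite_div \<alpha> \<phi> x) +
                (LINT x|lborel. min (f x) (g x) * hermite_div \<alpha> \<psi> x))
       \<le> ereal ((LINT x|lborel. max (f1 x) (g1 x) * hermite_div \<alpha> \<phi> x) +
                (LINT x|lborel. min (f1 x) (g1 x) * hermite_div \<alpha> \<psi> x)) + ereal (e - 2 * \<delta>)"
      using \<delta>(2) by simp
    also have "\<dots> \<le> (hermite_variation \<alpha> f1 + hermite_variation \<alpha> g1) + ereal (e - 2 * \<delta>)"
      by (intro add_right_mono smooth_submodular_duality f1 g1 \<phi> \<psi> \<alpha>)
    also have "\<dots> \<le> ((hermite_variation \<alpha> f + ereal \<delta>) + (hermite_variation \<alpha> g + ereal \<delta>)) + ereal (e - 2 * \<delta>)"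
      by (intro add_right_mono add_mono f1 g1)
    also have "\<dots> = (hermite_variation \<alpha> f + hermite_variation \<alpha> g) + ereal e"
      by (cases "hermite_variation \<alpha> f"; cases "hermite_variation \<alpha> g") auto
    finally show "ereal ((LINT x|lborel. max (f x) (g x) * hermite_div \<alpha> \<phi> x) +
                (LINT x|lborel. min (f x) (g x) * hermite_div \<alpha> \<psi> x))
      \<le> hermite_variation \<alpha> f + hermite_variation \<alpha> g + ereal e" .
  qed
  show ?thesis
  proof (cases "hermite_variation \<alpha> f + hermite_variation \<alpha> g")
    case (real c)
    have upper: "hermite_variation \<alpha> (\<lambda>x. max (f x) (g x))
        \<le> ereal (c - (LINT x|lborel. min (f x) (g x) * hermite_div \<alpha> \<psi> x))"
      if "\<psi> \<in> test_fields" for \<psi>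
    proof (rule hermite_variation_leI[OF _ \<alpha>])
      show "(\<lambda>x. max (f x) (g x)) \<in> borel_measurable borel" by measurable
      fix \<phi> :: "real^'d \<Rightarrow> real^('d + 'd)" assume "\<phi> \<in> test_fields"
      from dual[OF this that] real
      show "ereal (LINT x|lborel. max (f x) (g x) * hermite_div \<alpha> \<phi> x)
          \<le> ereal (c - (LINT x|lborel. min (f x) (g x) * hermite_div \<alpha> \<psi> x))" by simp
    qed
    then obtain m where m: "hermite_variation \<alpha> (\<lambda>x. max (f x) (g x)) = ereal m"
      using hermite_variation_nonneg[of \<alpha> "\<lambda>x. max (f x) (g x)"] zero_test_field
      by (cases "hermite_variation \<alpha> (\<lambda>x. max (f x) (g x))") fastforce+
    have "hermite_variation \<alpha> (\<lambda>x. min (f x) (g x)) \<le> ereal (c - m)"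
    proof (rule hermite_variation_leI[OF _ \<alpha>])
      show "(\<lambda>x. min (f x) (g x)) \<in> borel_measurable borel" by measurable
      fix \<psi> :: "real^'d \<Rightarrow> real^('d + 'd)" assume "\<psi> \<in> test_fields"
      from upper[OF this] m
      show "ereal (LINT x|lborel. min (f x) (g x) * hermite_div \<alpha> \<psi> x) \<le> ereal (c - m)" by simp
    qed
    then have "ereal m + hermite_variation \<alpha> (\<lambda>x. min (f x) (g x)) \<le> ereal m + ereal (c - m)"
      by (rule add_left_mono)
    then show ?thesis using m real by simp
  qed (use hermite_variation_nonneg[of \<alpha> f] hermite_variation_nonneg[of \<alpha> g] in auto)
qed

text \<open>Shifts and Fubini's theorem are applied to Borel functions with respect to \<open>lborel\<close>, whereas the
  variation is defined for Lebesgue measurable functions; this representative mediates, and the clamp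
  preserves the bound at every point.\<close>

lemma integrable_lebesgue_borel_representative:
  fixes f :: "'a::euclidean_space \<Rightarrow> real"
  assumes "integrable lebesgue f" "\<And>x. \<bar>f x\<bar> \<le> M"
  obtains f' where "integrable lborel f'" "\<And>x. \<bar>f' x\<bar> \<le> M" "AE x in lebesgue. f x = f' x"
    "f' \<in> borel_measurable lebesgue"
proof -
  have "f \<in> borel_measurable lebesgue" using assms(1) by auto
  then obtain h where h: "h \<in> borel_measurable lborel" "AE x in lborel. f x = h x"
    using completion_ex_borel_measurable_real by blast
  have [measurable]: "h \<in> borel_measurable borel" using h(1) by simp
  define f' where "f' x = max (- M) (min M (h x))" for x
  have M: "M \<ge> 0" using assms(2)[of 0] by linarith
  have f'm: "f' \<in> borel_measurable borel" unfolding f'_def by measurable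
  then have f'l: "f' \<in> borel_measurable lebesgue" by (intro measurable_completion) simp
  have "AE x in lebesgue. f x = h x" using h(2) by (simp add: AE_completion_iff)
  then have ae: "AE x in lebesgue. f x = f' x"
  proof (rule eventually_mono)
    fix x assume "f x = h x"
    then show "f x = f' x" using assms(2)[of x] by (auto simp: f'_def abs_le_iff)
  qed
  have "integrable lebesgue f'"
    using assms(1) integrable_cong_AE[OF _ f'l ae] by auto
  then have "integrable lborel f'" using integrable_completion[of f' lborel] f'm by simp
  then show thesis using that ae f'l M by (auto simp: f'_def)
qed

lemma hermite_variation_submodular:
  fixes f g :: "real^'d::finite \<Rightarrow> real"
  assumes \<alpha>: "\<alpha> > 0" and f: "integrable lebesgue f" "\<And>x. \<bar>f x\<bar> \<le> M"
    and g: "integrable lebesgue g" "\<And>x. \<bar>g x\<bar> \<le> M"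
  shows "hermite_variation \<alpha> (\<lambda>x. max (f x) (g x)) + hermite_variation \<alpha> (\<lambda>x. min (f x) (g x))
    \<le> hermite_variation \<alpha> f + hermite_variation \<alpha> g"
proof -
  obtain f' where f': "integrable lborel f'" "\<And>x. \<bar>f' x\<bar> \<le> M" "AE x in lebesgue. f x = f' x"
    "f' \<in> borel_measurable lebesgue"
    using integrable_lebesgue_borel_representative[OF f] by metis
  obtain g' where g': "integrable lborel g'" "\<And>x. \<bar>g' x\<bar> \<le> M" "AE x in lebesgue. g x = g' x"
    "g' \<in> borel_measurable lebesgue"
    using integrable_lebesgue_borel_representative[OF g] by metis
  have [measurable]: "f \<in> borel_measurable lebesgue" "g \<in> borel_measurable lebesgue" using f(1) g(1) by auto
  note [measurable] = f'(4) g'(4)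
  have "AE x in lebesgue. max (f x) (g x) = max (f' x) (g' x)" "AE x in lebesgue. min (f x) (g x) = min (f' x) (g' x)"
    using f'(3) g'(3) by auto
  then have "hermite_variation \<alpha> (\<lambda>x. max (f x) (g x)) = hermite_variation \<alpha> (\<lambda>x. max (f' x) (g' x))"
      "hermite_variation \<alpha> (\<lambda>x. min (f x) (g x)) = hermite_variation \<alpha> (\<lambda>x. min (f' x) (g' x))"
    by (intro hermite_variation_cong_AE \<alpha>; measurable)+
  moreover have "hermite_variation \<alpha> f = hermite_variation \<alpha> f'" "hermite_variation \<alpha> g = hermite_variation \<alpha> g'"
    using f'(3,4) g'(3,4) by (intro hermite_variation_cong_AE \<alpha>; simp)+
  ultimately show ?thesis
    using hermite_variation_submodular_borel[OF \<alpha> f'(1,2) g'(1,2)] by simp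
qed

section \<open>The capacity\<close>

definition hbv_norm :: "real \<Rightarrow> (real^'d::finite \<Rightarrow> real) \<Rightarrow> ereal" where
  "hbv_norm \<alpha> f = ereal (LINT x|lebesgue. \<bar>f x\<bar>) + hermite_variation \<alpha> f"

lemma hbv_norm_nonneg: "0 \<le> hbv_norm \<alpha> f"
  unfolding hbv_norm_def by (intro add_nonneg_nonneg hermite_variation_nonneg) simp

lemma hbv_norm_submodular:
  fixes f g :: "real^'d::finite \<Rightarrow> real"
  assumes \<alpha>: "\<alpha> > 0" and f: "integrable lebesgue f" "\<And>x. 0 \<le> f x \<and> f x \<le> 1"
    and g: "integrable lebesgue g" "\<And>x. 0 \<le> g x \<and> g x \<le> 1"
  shows "hbv_norm \<alpha> (\<lambda>x. max (f x) (g x)) + hbv_norm \<alpha> (\<lambda>x. min (f x) (g x)) \<le> hbv_norm \<alpha> f + hbv_norm \<alpha> g"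
proof -
  have "(LINT x|lebesgue. \<bar>max (f x) (g x)\<bar>) + (LINT x|lebesgue. \<bar>min (f x) (g x)\<bar>)
      = (LINT x|lebesgue. \<bar>max (f x) (g x)\<bar> + \<bar>min (f x) (g x)\<bar>)"
    using f(1) g(1) by simp
  also have "\<dots> = (LINT x|lebesgue. \<bar>f x\<bar> + \<bar>g x\<bar>)"
    by (rule arg_cong[where f = "integral\<^sup>L lebesgue"]) (auto simp: fun_eq_iff max_def min_def)
  also have "\<dots> = (LINT x|lebesgue. \<bar>f x\<bar>) + (LINT x|lebesgue. \<bar>g x\<bar>)"
    using f(1) g(1) by simp
  finally have L1: "ereal (LINT x|lebesgue. \<bar>max (f x) (g x)\<bar>) + ereal (LINT x|lebesgue. \<bar>min (f x) (g x)\<bar>)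
      = ereal (LINT x|lebesgue. \<bar>f x\<bar>) + ereal (LINT x|lebesgue. \<bar>g x\<bar>)" by simp
  have "hermite_variation \<alpha> (\<lambda>x. max (f x) (g x)) + hermite_variation \<alpha> (\<lambda>x. min (f x) (g x))
    \<le> hermite_variation \<alpha> f + hermite_variation \<alpha> g"
    using f g by (intro hermite_variation_submodular[OF \<alpha>, where M = 1]) auto
  from add_left_mono[OF this, of "ereal (LINT x|lebesgue. \<bar>max (f x) (g x)\<bar>) + ereal (LINT x|lebesgue. \<bar>min (f x) (g x)\<bar>)"]
  show ?thesis unfolding hbv_norm_def L1 by (subst (asm) L1[symmetric]) (simp add: ac_simps)
qed

text \<open>A Fatou property: tested against a fixed field, the integrals converge by dominated
  convergence, and the variation is a supremum of such tests.\<close>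

lemma hbv_norm_increasing_limit:
  fixes u :: "nat \<Rightarrow> real^'d::finite \<Rightarrow> real"
  assumes \<alpha>: "\<alpha> > 0" and u: "\<And>k. integrable lebesgue (u k)" "\<And>k x. 0 \<le> u k x"
    and mono: "\<And>k x. u k x \<le> u (Suc k) x" and lim: "\<And>x. (\<lambda>k. u k x) \<longlonglongrightarrow> v x"
    and c: "\<And>k. hbv_norm \<alpha> (u k) \<le> ereal c"
  shows "integrable lebesgue v" "hbv_norm \<alpha> v \<le> ereal c"
proof -
  have u_abs: "\<bar>u k x\<bar> = u k x" for k x using u(2) by simp
  have test: "(LINT x|lebesgue. u k x) + (LINT x|lebesgue. u k x * hermite_div \<alpha> \<phi> x) \<le> c"
    if "\<phi> \<in> test_fields" for \<phi> k
  proof -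
    have "ereal (LINT x|lebesgue. u k x * hermite_div \<alpha> \<phi> x) \<le> hermite_variation \<alpha> (u k)"
      unfolding hermite_variation_def using that by (rule SUP_upper)
    then have "ereal (LINT x|lebesgue. u k x) + ereal (LINT x|lebesgue. u k x * hermite_div \<alpha> \<phi> x) \<le> hbv_norm \<alpha> (u k)"
      unfolding hbv_norm_def u_abs by (rule add_left_mono)
    also have "\<dots> \<le> ereal c" by (rule c)
    finally show ?thesis by simp
  qed
  have um[measurable]: "u k \<in> borel_measurable lebesgue" for k using u(1) by auto
  have [measurable]: "v \<in> borel_measurable lebesgue"
    using um lim by (rule borel_measurable_LIMSEQ_real[rotated])
  have inc: "incseq (\<lambda>k. u k x)" for x using mono by (rule incseq_SucI)
  have "incseq (\<lambda>k. LINT x|lebesgue. u k x)"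
    using u(1) mono by (intro incseq_SucI integral_mono)
  moreover have "(LINT x|lebesgue. u k x) \<le> c" for k
    using test[OF zero_test_field, of k] by (simp add: hermite_div_zero)
  ultimately obtain I where I: "(\<lambda>k. LINT x|lebesgue. u k x) \<longlonglongrightarrow> I"
    using incseq_convergent by metis
  note mc = integral_monotone_convergence_nonneg[OF u(1) _ _ _ I]
  have v: "integrable lebesgue v" "(LINT x|lebesgue. v x) = I"
    by (rule mc; use inc u(2) lim in auto)+
  show "integrable lebesgue v" by (rule v)
  have uv: "u k x \<le> v x" for k x using incseq_le[OF inc lim] .
  have v0: "0 \<le> v x" for x using uv[of 0 x] u(2)[of 0 x] by linarith
  have "hermite_variation \<alpha> v \<le> ereal (c - (LINT x|lebesgue. v x))"
    unfolding hermite_variation_def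
  proof (rule SUP_least)
    fix \<phi> :: "real^'d \<Rightarrow> real^('d + 'd)" assume \<phi>: "\<phi> \<in> test_fields"
    obtain B where B: "\<And>x. \<bar>hermite_div \<alpha> \<phi> x\<bar> \<le> B" using hermite_div_test_field(3)[OF \<phi> \<alpha>] by blast
    have [measurable]: "hermite_div \<alpha> \<phi> \<in> borel_measurable lebesgue"
      using hermite_div_test_field(1)[OF \<phi> \<alpha>] by (intro measurable_completion) simp
    have "(\<lambda>k. LINT x|lebesgue. u k x * hermite_div \<alpha> \<phi> x) \<longlonglongrightarrow> (LINT x|lebesgue. v x * hermite_div \<alpha> \<phi> x)"
    proof (rule integral_dominated_convergence[where w = "\<lambda>x. v x * B"])
      show "AE x in lebesgue. norm (u k x * hermite_div \<alpha> \<phi> x) \<le> v x * B" for k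
        using uv u(2) B v0 by (intro AE_I2) (auto simp: abs_mult intro!: mult_mono)
      show "AE x in lebesgue. (\<lambda>k. u k x * hermite_div \<alpha> \<phi> x) \<longlonglongrightarrow> v x * hermite_div \<alpha> \<phi> x"
        by (intro AE_I2 tendsto_intros lim)
    qed (use v(1) in auto)
    then have "(\<lambda>k. (LINT x|lebesgue. u k x) + (LINT x|lebesgue. u k x * hermite_div \<alpha> \<phi> x))
        \<longlonglongrightarrow> (LINT x|lebesgue. v x) + (LINT x|lebesgue. v x * hermite_div \<alpha> \<phi> x)"
      unfolding v(2) by (intro tendsto_add I)
    then have "(LINT x|lebesgue. v x) + (LINT x|lebesgue. v x * hermite_div \<alpha> \<phi> x) \<le> c"
      by (rule LIMSEQ_le_const2) (use test[OF \<phi>] in auto)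
    then show "ereal (LINT x|lebesgue. v x * hermite_div \<alpha> \<phi> x) \<le> ereal (c - (LINT x|lebesgue. v x))" by simp
  qed
  then have "hbv_norm \<alpha> v \<le> ereal (LINT x|lebesgue. \<bar>v x\<bar>) + ereal (c - (LINT x|lebesgue. v x))"
    unfolding hbv_norm_def by (rule add_left_mono)
  then show "hbv_norm \<alpha> v \<le> ereal c" using v0 by simp
qed

lemma hbv_cap_eq: "hbv_cap \<alpha> E = (INF f\<in>cap_admissible \<alpha> E. hbv_norm \<alpha> f)"
  by (simp add: hbv_cap_def hbv_norm_def)

lemma hbv_cap_le: "f \<in> cap_admissible \<alpha> E \<Longrightarrow> hbv_cap \<alpha> E \<le> hbv_norm \<alpha> f"
  unfolding hbv_cap_eq by (rule INF_lower)

lemma hbv_cap_nonneg: "0 \<le> hbv_cap \<alpha> E"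
  unfolding hbv_cap_eq by (intro INF_greatest hbv_norm_nonneg)

lemma hbv_cap_approx:
  assumes "hbv_cap \<alpha> E = ereal c" "e > 0"
  obtains f where "f \<in> cap_admissible \<alpha> E" "hbv_norm \<alpha> f \<le> ereal (c + e)"
proof -
  have "hbv_cap \<alpha> E < ereal (c + e)" using assms by simp
  then show thesis using that unfolding hbv_cap_eq INF_less_iff by (auto intro: less_imp_le)
qed

lemma hbv_cap_mono: "A \<subseteq> B \<Longrightarrow> hbv_cap \<alpha> A \<le> hbv_cap \<alpha> B"
  unfolding hbv_cap_eq by (rule INF_superset_mono) (auto simp: cap_admissible_def)

lemma hbv_cap_empty: "hbv_cap \<alpha> {} = 0"
proof (rule antisym)
  have "(\<lambda>x. 0) \<in> cap_admissible \<alpha> {}"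
    by (auto simp: cap_admissible_def hermite_BV_def hermite_variation_zero intro!: exI[of _ "{}"])
  from hbv_cap_le[OF this] show "hbv_cap \<alpha> {} \<le> 0"
    by (simp add: hbv_norm_def hermite_variation_zero zero_ereal_def[symmetric])
qed (rule hbv_cap_nonneg)

lemma cap_admissibleD:
  assumes "f \<in> cap_admissible \<alpha> E"
  shows "integrable lebesgue f" "0 \<le> f x \<and> f x \<le> 1" "hbv_norm \<alpha> f < \<infinity>"
  using assms by (auto simp: cap_admissible_def hermite_BV_def hbv_norm_def)

lemma cap_admissible_neighbourhood:
  assumes "f \<in> cap_admissible \<alpha> E"
  obtains U where "open U" "E \<subseteq> U" "\<And>x. x \<in> U \<Longrightarrow> f x = 1"
  using assms unfolding cap_admissible_def by blast

lemma cap_admissibleI: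
  assumes "integrable lebesgue f" "\<And>x. 0 \<le> f x \<and> f x \<le> 1" "hbv_norm \<alpha> f < \<infinity>"
    and "open U" "E \<subseteq> U" "\<And>x. x \<in> U \<Longrightarrow> f x = 1"
  shows "f \<in> cap_admissible \<alpha> E"
proof -
  have "hermite_variation \<alpha> f < \<infinity>" using assms(3) by (auto simp: hbv_norm_def)
  then show ?thesis using assms unfolding cap_admissible_def hermite_BV_def by blast
qed

lemma cap_admissible_max_min:
  assumes \<alpha>: "\<alpha> > 0" and f: "f \<in> cap_admissible \<alpha> A" and g: "g \<in> cap_admissible \<alpha> B"
  shows "(\<lambda>x. max (f x) (g x)) \<in> cap_admissible \<alpha> (A \<union> B)"
    and "(\<lambda>x. min (f x) (g x)) \<in> cap_admissible \<alpha> (A \<inter> B)"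
    and "hbv_norm \<alpha> (\<lambda>x. max (f x) (g x)) + hbv_norm \<alpha> (\<lambda>x. min (f x) (g x)) \<le> hbv_norm \<alpha> f + hbv_norm \<alpha> g"
proof -
  note f' = cap_admissibleD[OF f] and g' = cap_admissibleD[OF g]
  show sub: "hbv_norm \<alpha> (\<lambda>x. max (f x) (g x)) + hbv_norm \<alpha> (\<lambda>x. min (f x) (g x)) \<le> hbv_norm \<alpha> f + hbv_norm \<alpha> g"
    using f'(1,2) g'(1,2) by (rule hbv_norm_submodular[OF \<alpha>])
  also have "hbv_norm \<alpha> f + hbv_norm \<alpha> g < \<infinity>" using f'(3) g'(3) by simp
  finally have "hbv_norm \<alpha> (\<lambda>x. max (f x) (g x)) + hbv_norm \<alpha> (\<lambda>x. min (f x) (g x)) < \<infinity>" .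
  then have fin: "hbv_norm \<alpha> (\<lambda>x. max (f x) (g x)) < \<infinity>" "hbv_norm \<alpha> (\<lambda>x. min (f x) (g x)) < \<infinity>"
    by auto
  obtain U where U: "open U" "A \<subseteq> U" "\<And>x. x \<in> U \<Longrightarrow> f x = 1"
    using f by (rule cap_admissible_neighbourhood) blast
  obtain V where V: "open V" "B \<subseteq> V" "\<And>x. x \<in> V \<Longrightarrow> g x = 1"
    using g by (rule cap_admissible_neighbourhood) blast
  show "(\<lambda>x. max (f x) (g x)) \<in> cap_admissible \<alpha> (A \<union> B)"
  proof (rule cap_admissibleI[where U = "U \<union> V"])
    show "max (f x) (g x) = 1" if "x \<in> U \<union> V" for x
      using that U(3)[of x] V(3)[of x] f'(2)[of x] g'(2)[of x] by auto
    show "0 \<le> max (f x) (g x) \<and> max (f x) (g x) \<le> 1" for x using f'(2)[of x] g'(2)[of x] by auto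
  qed (use f'(1) g'(1) fin U V in auto)
  show "(\<lambda>x. min (f x) (g x)) \<in> cap_admissible \<alpha> (A \<inter> B)"
  proof (rule cap_admissibleI[where U = "U \<inter> V"])
    show "0 \<le> min (f x) (g x) \<and> min (f x) (g x) \<le> 1" for x using f'(2)[of x] g'(2)[of x] by auto
  qed (use f'(1) g'(1) fin U V in auto)
qed

lemma hbv_cap_strong_subadditive:
  fixes A B :: "(real^'d::finite) set"
  assumes \<alpha>: "\<alpha> > 0"
  shows "hbv_cap \<alpha> (A \<union> B) + hbv_cap \<alpha> (A \<inter> B) \<le> hbv_cap \<alpha> A + hbv_cap \<alpha> B"
proof (cases "hbv_cap \<alpha> A = \<infinity> \<or> hbv_cap \<alpha> B = \<infinity>")
  case False
  then obtain a b where ab: "hbv_cap \<alpha> A = ereal a" "hbv_cap \<alpha> B = ereal b"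
    using hbv_cap_nonneg[of \<alpha> A] hbv_cap_nonneg[of \<alpha> B]
    by (cases "hbv_cap \<alpha> A"; cases "hbv_cap \<alpha> B") auto
  show ?thesis
  proof (rule ereal_le_epsilon2)
    fix e :: real assume "e > 0"
    then have e2: "e / 2 > 0" by simp
    obtain f where f: "f \<in> cap_admissible \<alpha> A" "hbv_norm \<alpha> f \<le> ereal (a + e / 2)"
      using ab(1) e2 by (rule hbv_cap_approx)
    obtain g where g: "g \<in> cap_admissible \<alpha> B" "hbv_norm \<alpha> g \<le> ereal (b + e / 2)"
      using ab(2) e2 by (rule hbv_cap_approx)
    note mm = cap_admissible_max_min[OF \<alpha> f(1) g(1)]
    have "hbv_cap \<alpha> (A \<union> B) + hbv_cap \<alpha> (A \<inter> B)
        \<le> hbv_norm \<alpha> (\<lambda>x. max (f x) (g x)) + hbv_norm \<alpha> (\<lambda>x. min (f x) (g x))"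
      by (intro add_mono hbv_cap_le mm)
    also have "\<dots> \<le> hbv_norm \<alpha> f + hbv_norm \<alpha> g" by (rule mm)
    also have "\<dots> \<le> ereal (a + e / 2) + ereal (b + e / 2)" by (intro add_mono f g)
    also have "\<dots> = hbv_cap \<alpha> A + hbv_cap \<alpha> B + ereal e" by (simp add: ab)
    finally show "hbv_cap \<alpha> (A \<union> B) + hbv_cap \<alpha> (A \<inter> B) \<le> hbv_cap \<alpha> A + hbv_cap \<alpha> B + ereal e" .
  qed
qed (use hbv_cap_nonneg[of \<alpha> A] hbv_cap_nonneg[of \<alpha> B] in auto)

text \<open>The \<open>k\<close>-th function competes for \<open>S k\<close> up to \<open>e / 2^(k+1)\<close>. Running maxima accumulate these
  errors, whose sum is at most \<open>e\<close>: in each step submodularity replaces \<open>cap (S k)\<close> by \<open>cap (S (k + 1))\<close>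
  and adds only the new error.\<close>

lemma hbv_cap_increasing_union_le:
  fixes S :: "nat \<Rightarrow> (real^'d::finite) set"
  assumes \<alpha>: "\<alpha> > 0" and S: "\<And>k. S k \<subseteq> S (Suc k)" and L: "\<And>k. hbv_cap \<alpha> (S k) \<le> ereal L" and e: "e > 0"
  shows "hbv_cap \<alpha> (\<Union>k. S k) \<le> ereal (L + e)"
proof -
  have "\<exists>r. hbv_cap \<alpha> (S k) = ereal r" for k
    using L[of k] hbv_cap_nonneg[of \<alpha> "S k"] by (cases "hbv_cap \<alpha> (S k)") auto
  then obtain r where r: "\<And>k. hbv_cap \<alpha> (S k) = ereal (r k)" by metis
  have rL: "r k \<le> L" for k using L[of k] r by simp
  have "\<exists>f. f \<in> cap_admissible \<alpha> (S k) \<and> hbv_norm \<alpha> f \<le> ereal (r k + e * (1/2) ^ Suc k)" for k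
  proof -
    have "e * (1/2) ^ Suc k > 0" using e by simp
    then show ?thesis using hbv_cap_approx[OF r] by metis
  qed
  then obtain u where u: "\<And>k. u k \<in> cap_admissible \<alpha> (S k)"
      "\<And>k. hbv_norm \<alpha> (u k) \<le> ereal (r k + e * (1/2) ^ Suc k)" by metis
  define g where "g = rec_nat (u 0) (\<lambda>k h x. max (h x) (u (Suc k) x))"
  have g_simps: "g 0 = u 0" "g (Suc k) = (\<lambda>x. max (g k x) (u (Suc k) x))" for k
    by (simp_all add: g_def)
  have g: "g k \<in> cap_admissible \<alpha> (S k) \<and> hbv_norm \<alpha> (g k) \<le> ereal (r k + e * (1 - (1/2) ^ Suc k))" for k
  proof (induction k)
    case 0
    then show ?case using u(1)[of 0] u(2)[of 0] by (simp add: g_simps)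
  next
    case (Suc k)
    note mm = cap_admissible_max_min[OF \<alpha> conjunct1[OF Suc] u(1)[of "Suc k"], folded g_simps]
    have "S k \<union> S (Suc k) = S (Suc k)" "S k \<inter> S (Suc k) = S k" using S[of k] by auto
    then have adm: "g (Suc k) \<in> cap_admissible \<alpha> (S (Suc k))"
      and "(\<lambda>x. min (g k x) (u (Suc k) x)) \<in> cap_admissible \<alpha> (S k)"
      using mm(1,2) by auto
    \<comment> \<open>the minimum still competes for \<open>S k\<close>, so it gives back the capacity of \<open>S k\<close>\<close>
    then have "ereal (r k) \<le> hbv_norm \<alpha> (\<lambda>x. min (g k x) (u (Suc k) x))"
      using hbv_cap_le r by metis
    then have "hbv_norm \<alpha> (g (Suc k)) + ereal (r k) \<le> hbv_norm \<alpha> (g k) + hbv_norm \<alpha> (u (Suc k))"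
      using mm(3) by (meson add_left_mono order_trans)
    also have "\<dots> \<le> ereal (r k + e * (1 - (1/2) ^ Suc k)) + ereal (r (Suc k) + e * (1/2) ^ Suc (Suc k))"
      using Suc u(2)[of "Suc k"] by (intro add_mono) auto
    finally have "hbv_norm \<alpha> (g (Suc k)) \<le> ereal (r (Suc k) + e * (1 - (1/2) ^ Suc (Suc k)))"
      by (cases "hbv_norm \<alpha> (g (Suc k))") (auto simp: algebra_simps)
    then show ?case using adm by simp
  qed
  have g01: "0 \<le> g k x \<and> g k x \<le> 1" for k x using cap_admissibleD(2) g by blast
  have g_mono: "g k x \<le> g (Suc k) x" for k x by (simp add: g_simps)
  define G where "G x = (SUP k. g k x)" for x
  have bdd: "bdd_above (range (\<lambda>k. g k x))" for x using g01 by (intro bdd_aboveI[of _ 1]) auto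
  have lim: "(\<lambda>k. g k x) \<longlonglongrightarrow> G x" for x
    unfolding G_def using bdd incseq_SucI[of "\<lambda>k. g k x", OF g_mono] by (rule LIMSEQ_incseq_SUP)
  have norm_g: "hbv_norm \<alpha> (g k) \<le> ereal (L + e)" for k
  proof -
    have "e * (1 - (1/2) ^ Suc k) \<le> e * 1" using e by (intro mult_left_mono) auto
    then have "r k + e * (1 - (1/2) ^ Suc k) \<le> L + e" using rL[of k] by simp
    then show ?thesis using g by (meson ereal_less_eq(3) order_trans)
  qed
  have int_g: "integrable lebesgue (g k)" for k using cap_admissibleD(1) g by blast
  note G = hbv_norm_increasing_limit[OF \<alpha> int_g conjunct1[OF g01] g_mono lim norm_g]
  have "\<exists>U. open U \<and> S k \<subseteq> U \<and> (\<forall>x\<in>U. g k x = 1)" for k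
    using g[of k] unfolding cap_admissible_def by blast
  then obtain U where U: "\<And>k. open (U k)" "\<And>k. S k \<subseteq> U k" "\<And>k x. x \<in> U k \<Longrightarrow> g k x = 1" by metis
  have gG: "g k x \<le> G x" for k x unfolding G_def using bdd by (intro cSUP_upper) auto
  have G1: "G x \<le> 1" for x unfolding G_def using g01 by (intro cSUP_least) auto
  have "G \<in> cap_admissible \<alpha> (\<Union>k. S k)"
  proof (rule cap_admissibleI[where U = "\<Union>k. U k"])
    show "0 \<le> G x \<and> G x \<le> 1" for x using gG[of 0 x] g01[of 0 x] G1[of x] by auto
    show "G x = 1" if x: "x \<in> (\<Union>k. U k)" for x
    proof -
      obtain k where "x \<in> U k" using x by blast
      then show ?thesis using U(3)[of x k] gG[of k x] G1[of x] by simp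
    qed
    show "hbv_norm \<alpha> G < \<infinity>" using G(2) by auto
  qed (use G(1) U in auto)
  from hbv_cap_le[OF this] G(2) show ?thesis by (rule order_trans)
qed

lemma hbv_cap_increasing_union:
  fixes S :: "nat \<Rightarrow> (real^'d::finite) set"
  assumes \<alpha>: "\<alpha> > 0" and S: "\<And>k. S k \<subseteq> S (Suc k)"
  shows "(\<lambda>k. hbv_cap \<alpha> (S k)) \<longlonglongrightarrow> hbv_cap \<alpha> (\<Union>k. S k)"
proof -
  have "incseq (\<lambda>k. hbv_cap \<alpha> (S k))" using S by (intro incseq_SucI hbv_cap_mono)
  then have "(\<lambda>k. hbv_cap \<alpha> (S k)) \<longlonglongrightarrow> (SUP k. hbv_cap \<alpha> (S k))" by (rule LIMSEQ_SUP)
  moreover have "(SUP k. hbv_cap \<alpha> (S k)) = hbv_cap \<alpha> (\<Union>k. S k)"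
  proof (rule antisym)
    show "(SUP k. hbv_cap \<alpha> (S k)) \<le> hbv_cap \<alpha> (\<Union>k. S k)"
      by (intro SUP_least hbv_cap_mono) auto
    show "hbv_cap \<alpha> (\<Union>k. S k) \<le> (SUP k. hbv_cap \<alpha> (S k))"
    proof (cases "(SUP k. hbv_cap \<alpha> (S k))")
      case (real L)
      have "hbv_cap \<alpha> (S k) \<le> ereal L" for k
        unfolding real[symmetric] by (rule SUP_upper) simp
      then have "hbv_cap \<alpha> (\<Union>k. S k) \<le> ereal L + ereal e" if "e > 0" for e
        using hbv_cap_increasing_union_le[of \<alpha> S L e, OF \<alpha> S _ that] by simp
      then show ?thesis unfolding real by (rule ereal_le_epsilon2)
    next
      case MInf
      have "hbv_cap \<alpha> (S 0) \<le> (SUP k. hbv_cap \<alpha> (S k))" by (rule SUP_upper) simp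
      then show ?thesis using MInf hbv_cap_nonneg[of \<alpha> "S 0"] by simp
    qed simp
  qed
  ultimately show ?thesis by simp
qed

text \<open>Finite subadditivity of the partial unions passes to the limit along their increasing sequence.\<close>

lemma hbv_cap_countably_subadditive:
  fixes S :: "nat \<Rightarrow> (real^'d::finite) set"
  assumes \<alpha>: "\<alpha> > 0"
  shows "hbv_cap \<alpha> (\<Union>k. S k) \<le> (\<Sum>k. hbv_cap \<alpha> (S k))"
proof -
  define T where "T n = (\<Union>k<n. S k)" for n
  have T_le: "hbv_cap \<alpha> (T n) \<le> (\<Sum>k<n. hbv_cap \<alpha> (S k))" for n
  proof (induction n)
    case 0
    show ?case by (simp add: T_def hbv_cap_empty)
  next
    case (Suc n)
    have "T (Suc n) = T n \<union> S n" by (auto simp: T_def less_Suc_eq)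
    then have "hbv_cap \<alpha> (T (Suc n)) \<le> hbv_cap \<alpha> (T n \<union> S n) + hbv_cap \<alpha> (T n \<inter> S n)"
      using hbv_cap_nonneg[of \<alpha> "T n \<inter> S n"] by (simp add: add_increasing2)
    also have "\<dots> \<le> hbv_cap \<alpha> (T n) + hbv_cap \<alpha> (S n)" by (rule hbv_cap_strong_subadditive[OF \<alpha>])
    also have "\<dots> \<le> (\<Sum>k<n. hbv_cap \<alpha> (S k)) + hbv_cap \<alpha> (S n)" using Suc by (rule add_right_mono)
    finally show ?case by simp
  qed
  have "(\<lambda>n. hbv_cap \<alpha> (T n)) \<longlonglongrightarrow> hbv_cap \<alpha> (\<Union>n. T n)"
    unfolding T_def by (rule hbv_cap_increasing_union[OF \<alpha>]) (intro UN_mono; auto)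
  moreover have "(\<Union>n. T n) = (\<Union>k. S k)" by (auto simp: T_def)
  moreover have "hbv_cap \<alpha> (T n) \<le> (\<Sum>k. hbv_cap \<alpha> (S k))" for n
    using T_le[of n] sum_le_suminf[OF summable_ereal_pos, of "\<lambda>k. hbv_cap \<alpha> (S k)" "{..<n}"] hbv_cap_nonneg
    by (auto intro: order_trans)
  ultimately show ?thesis by (metis LIMSEQ_le_const2)
qed

text \<open>If no \<open>S k\<close> were contained in the neighbourhood \<open>U\<close> of the intersection, the sets \<open>S k - U\<close> would be
  nested nonempty compact sets, with a common point outside \<open>U\<close>.\<close>

lemma hbv_cap_decreasing_compact:
  fixes S :: "nat \<Rightarrow> (real^'d::finite) set"
  assumes comp: "\<And>k. compact (S k)" and S: "\<And>k. S (Suc k) \<subseteq> S k"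
  shows "(\<lambda>k. hbv_cap \<alpha> (S k)) \<longlonglongrightarrow> hbv_cap \<alpha> (\<Inter>k. S k)"
proof -
  have dec: "S n \<subseteq> S m" if "m \<le> n" for m n using S that by (rule lift_Suc_antimono_le)
  have "decseq (\<lambda>k. hbv_cap \<alpha> (S k))" using S by (intro decseq_SucI hbv_cap_mono)
  then have "(\<lambda>k. hbv_cap \<alpha> (S k)) \<longlonglongrightarrow> (INF k. hbv_cap \<alpha> (S k))" by (rule LIMSEQ_INF)
  moreover have "(INF k. hbv_cap \<alpha> (S k)) = hbv_cap \<alpha> (\<Inter>k. S k)"
  proof (rule antisym)
    show "hbv_cap \<alpha> (\<Inter>k. S k) \<le> (INF k. hbv_cap \<alpha> (S k))"
      by (intro INF_greatest hbv_cap_mono) auto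
    have "(INF k. hbv_cap \<alpha> (S k)) \<le> hbv_norm \<alpha> f" if f: "f \<in> cap_admissible \<alpha> (\<Inter>k. S k)" for f
    proof -
      obtain U where U: "open U" "(\<Inter>k. S k) \<subseteq> U" "\<And>x. x \<in> U \<Longrightarrow> f x = 1"
        using f by (rule cap_admissible_neighbourhood) blast
      have "\<exists>k. S k \<subseteq> U"
      proof (rule ccontr)
        assume "\<not> ?thesis"
        then have "\<Inter>(range (\<lambda>k. S k - U)) \<noteq> {}"
          using comp U(1) dec by (intro compact_nest compact_diff) blast+
        then show False using U(2) by blast
      qed
      then obtain k where "S k \<subseteq> U" by blast
      then have "f \<in> cap_admissible \<alpha> (S k)"
        using cap_admissibleD[OF f] U by (intro cap_admissibleI[where U = U]) auto
      then have "hbv_cap \<alpha> (S k) \<le> hbv_norm \<alpha> f" by (rule hbv_cap_le)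
      then show ?thesis by (rule INF_lower2[OF UNIV_I])
    qed
    then show "(INF k. hbv_cap \<alpha> (S k)) \<le> hbv_cap \<alpha> (\<Inter>k. S k)"
      unfolding hbv_cap_eq[of \<alpha> "\<Inter>k. S k"] by (rule INF_greatest)
  qed
  ultimately show ?thesis by simp
qed

theorem theorem2p3:
  fixes \<alpha> :: real and A B :: "(real^'d::finite) set"
  assumes "CARD('d) \<ge> 2" and "\<alpha> \<ge> 1"
  shows
    "hbv_cap \<alpha> ({} :: (real^'d) set) = 0 \<and>
     (A \<subseteq> B \<longrightarrow> hbv_cap \<alpha> A \<le> hbv_cap \<alpha> B) \<and>
     hbv_cap \<alpha> (A \<union> B) + hbv_cap \<alpha> (A \<inter> B) \<le> hbv_cap \<alpha> A + hbv_cap \<alpha> B \<and>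
     (\<forall>S :: nat \<Rightarrow> (real^'d) set.
        hbv_cap \<alpha> (\<Union>k. S k) \<le> (\<Sum>k. hbv_cap \<alpha> (S k))) \<and>
     (\<forall>S :: nat \<Rightarrow> (real^'d) set. (\<forall>k. S k \<subseteq> S (Suc k)) \<longrightarrow>
        (\<lambda>k. hbv_cap \<alpha> (S k)) \<longlonglongrightarrow> hbv_cap \<alpha> (\<Union>k. S k)) \<and>
     (\<forall>S :: nat \<Rightarrow> (real^'d) set. (\<forall>k. compact (S k)) \<and> (\<forall>k. S (Suc k) \<subseteq> S k) \<longrightarrow>
        (\<lambda>k. hbv_cap \<alpha> (S k)) \<longlonglongrightarrow> hbv_cap \<alpha> (\<Inter>k. S k))"
proof -
  have \<alpha>: "\<alpha> > 0" using assms(2) by simp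
  show ?thesis
  proof (intro conjI impI allI)
    fix S :: "nat \<Rightarrow> (real^'d) set" assume "(\<forall>k. compact (S k)) \<and> (\<forall>k. S (Suc k) \<subseteq> S k)"
    then show "(\<lambda>k. hbv_cap \<alpha> (S k)) \<longlonglongrightarrow> hbv_cap \<alpha> (\<Inter>k. S k)"
      by (intro hbv_cap_decreasing_compact) auto
  qed (auto intro!: hbv_cap_empty hbv_cap_mono hbv_cap_strong_subadditive hbv_cap_countably_subadditive
      hbv_cap_increasing_union \<alpha>)
qed

end
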